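(* Let $r\ge1$ and let $(T_{\alpha,j,k})$, indexed by $\alpha\in\{0,\dots,r+1\}$, $j,k\in\mathbb Z$ with $\alpha+j+k$ even, satisfy the $A_r$ $T$-system $$T_{\alpha,j,k+1}T_{\alpha,j,k-1}=T_{\alpha,j+1,k}T_{\alpha,j-1,k}+T_{\alpha+1,j,k}T_{\alpha-1,j,k}\quad(1\le\alpha\le r),\qquad T_{0,j,k}=T_{r+1,j,k}=1.$$ Let $\mathbf k=(k_{\alpha,j})_{1\le\alpha\le r,\,j\in\mathbb Z}$ be a stepped surface, i.e. $k_{\alpha,j}\in\mathbb Z$, $\alpha+j+k_{\alpha,j}$ even, $k_{\alpha+1,j}-k_{\alpha,j}=\pm1$ and $k_{\alpha,j+1}-k_{\alpha,j}=\pm1$, and assume moreover that $\mathbf k$ is 2-periodic: $k_{\alpha,j+2}=k_{\alpha,j}$ for all $\alpha,j$. Regard the initial data $\mathbf x_{\mathbf k}=\{T_{\alpha,j,k_{\alpha,j}}\}_{1\le\alpha\le r,\,j\in\mathbb Z}$ as independent commuting indeterminates (the system then determines all $T_{\alpha,j,k}$). Then every $T_{\alpha,j,k}$ ($1\le\alpha\le r$) is a Laurent polynomial in finitely many variables of $\mathbf x_{\mathbf k}$ with non-negative integer coefficients. *)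

theory Defs
  imports Main "HOL-Library.Poly_Mapping"
begin

text \<open>Laurent polynomials with integer coefficients in the commuting indeterminates
  x_(alpha,j), indexed by (alpha,j) :: nat * int.  A Laurent monomial is a finitely
  supported exponent vector (nat * int) =>0 int; a Laurent polynomial is a finitely
  supported map from monomials to coefficients, with convolution product.  Finite
  support means each Laurent polynomial involves only finitely many variables.\<close>

type_synonym laurent = "((nat \<times> int) \<Rightarrow>\<^sub>0 int) \<Rightarrow>\<^sub>0 int"

definition lvar :: "nat \<Rightarrow> int \<Rightarrow> laurent" where
  "lvar a j = Poly_Mapping.single (Poly_Mapping.single (a, j) 1) 1"

definition nonneg_coeffs :: "laurent \<Rightarrow> bool" where
  "nonneg_coeffs P \<longleftrightarrow> (\<forall>m. Poly_Mapping.lookup P m \<ge> 0)"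

definition stepped_surface :: "nat \<Rightarrow> (nat \<Rightarrow> int \<Rightarrow> int) \<Rightarrow> bool" where
  "stepped_surface r kk \<longleftrightarrow>
     (\<forall>a j. 1 \<le> a \<and> a \<le> r \<longrightarrow> even (int a + j + kk a j)) \<and>
     (\<forall>a j. 1 \<le> a \<and> a < r \<longrightarrow> \<bar>kk (a+1) j - kk a j\<bar> = 1) \<and>
     (\<forall>a j. 1 \<le> a \<and> a \<le> r \<longrightarrow> \<bar>kk a (j+1) - kk a j\<bar> = 1)"

text \<open>The A_r T-system with boundary conditions T_0 = T_(r+1) = 1, on the lattice
  points alpha + j + k even.  The exchange relation is centred at (alpha,j,k) with
  alpha + j + k odd, so that all six entries lie on the even sublattice.\<close>
definition T_system :: "nat \<Rightarrow> (nat \<Rightarrow> int \<Rightarrow> int \<Rightarrow> 'a::comm_ring_1) \<Rightarrow> bool" where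
  "T_system r T \<longleftrightarrow>
     (\<forall>j k. even (j + k) \<longrightarrow> T 0 j k = 1) \<and>
     (\<forall>j k. even (int (r+1) + j + k) \<longrightarrow> T (r+1) j k = 1) \<and>
     (\<forall>a j k. 1 \<le> a \<and> a \<le> r \<and> odd (int a + j + k) \<longrightarrow>
        T a j (k+1) * T a j (k-1) = T a (j+1) k * T a (j-1) k + T (a+1) j k * T (a-1) j k)"

end

theory Submission
  imports Defs "HOL-Library.Product_Lexorder" "HOL-Computational_Algebra.Polynomial_Factorial"
begin

text \<open>Following Di Francesco and Kedem, read a stepped surface along a row: a descending step
  \<open>a, b\<close> in row \<open>i\<close> gives the matrix with rows \<open>(1, 0), (u/b, a/b)\<close> and an ascending step
  \<open>b, c\<close> the matrix with rows \<open>(b/c, v/c), (0, 1)\<close>, acting on the coordinates \<open>i, i + 1\<close>,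
  where \<open>u\<close> is a neighbour in row \<open>i + 1\<close> and \<open>v\<close> one in row \<open>i - 1\<close>. The T-system relation
  \<open>x b = u v + a c\<close> says exactly that the ordered product of these matrices between two columns
  does not change when a local minimum \<open>b\<close> of the surface is raised to \<open>x\<close>. Raising the surface
  to a mountain with summit \<open>(\<alpha>, j, k)\<close>, ascending steps on the left and descending ones on
  the right, makes the minor on the coordinates \<open>> \<alpha>\<close> equal to \<open>T\<^sub>\<alpha>\<^sub>,\<^sub>j\<^sub>,\<^sub>k\<close> times a Laurent
  monomial in boundary values. On the original surface the same minor is a polynomial with
  non-negative coefficients in the matrix entries. Working with the induced action on the
  exterior algebra from the start treats all minors at once and avoids determinants.\<close>

subsection \<open>Local operators on the exterior algebra\<close>

text \<open>A state assigns a coefficient to each basis vector of the exterior algebra, encoded as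
  the indicator function \<open>J\<close> of its index set; the operators act on states as row vectors, so
  that \<open>opV \<dots> (opU \<dots> f)\<close> is \<open>f\<close> times the \<open>U\<close>-matrix times the \<open>V\<close>-matrix. No signs occur
  because only adjacent indices are exchanged.\<close>

definition opU :: "nat \<Rightarrow> 'a::field \<Rightarrow> 'a \<Rightarrow> 'a \<Rightarrow> ((nat \<Rightarrow> bool) \<Rightarrow> 'a) \<Rightarrow> (nat \<Rightarrow> bool) \<Rightarrow> 'a" where
  "opU i a b u f J = (if J (Suc i) then a / b else 1) * f J +
     (if J i \<and> \<not> J (Suc i) then u / b * f (J(i := False, Suc i := True)) else 0)"

definition opV :: "nat \<Rightarrow> 'a::field \<Rightarrow> 'a \<Rightarrow> 'a \<Rightarrow> ((nat \<Rightarrow> bool) \<Rightarrow> 'a) \<Rightarrow> (nat \<Rightarrow> bool) \<Rightarrow> 'a" where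
  "opV i v b c f J = (if J i then b / c else 1) * f J +
     (if \<not> J i \<and> J (Suc i) then v / c * f (J(i := True, Suc i := False)) else 0)"

text \<open>On index sets containing both or neither of \<open>i\<close>, \<open>Suc i\<close> the
  two sides agree through the determinants, \<open>a / c\<close> or \<open>1\<close>. The relation
  enters on the mixed sets, where it reads as the two diagonal entries of the 2 by 2 product, facts
  \<open>1\<close> and \<open>2\<close>.\<close>

lemma opU_opV_mutation:
  assumes "x * b = u * v + a * c" "x \<noteq> 0" "b \<noteq> 0" "c \<noteq> (0::'a::field)"
  shows "opV i v b c (opU i a b u f) = opU i x c u (opV i v a x f)"
proof
  fix J
  have "c * (a * c + u * v) = c * (x * b)" using assms(1) by (simp add: add.commute)
  then have 1: "a / x + u * v / (x * c) = b / c"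
    using assms(2-4) by (simp add: field_simps)
  have 2: "x / c = u * v / (b * c) + a / b"
    using assms by (simp add: field_simps)
  have upd: "J i \<Longrightarrow> \<not> J (Suc i) \<Longrightarrow> J(i := True, Suc i := False) = J"
    "\<not> J i \<Longrightarrow> J (Suc i) \<Longrightarrow> J(i := False, Suc i := True) = J"
    by (auto simp: fun_eq_iff)
  have upd': "J(i := x, Suc i := y, i := z, Suc i := w) = J(i := z, Suc i := w)" for x y z w
    by (auto simp: fun_eq_iff)
  show "opV i v b c (opU i a b u f) J = opU i x c u (opV i v a x f) J"
  proof (cases "J i")
    case True
    show ?thesis
    proof (cases "J (Suc i)")
      case True
      then show ?thesis using \<open>J i\<close> assms by (simp add: opU_def opV_def)
    next
      case False
      have "opU i x c u (opV i v a x f) J = (a / x + u * v / (x * c)) * f J + u / c * f (J(i := False, Suc i := True))"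
        using True False assms upd by (simp add: opU_def opV_def upd' field_simps)
      moreover have "opV i v b c (opU i a b u f) J = b / c * f J + u / c * f (J(i := False, Suc i := True))"
        using True False assms by (simp add: opU_def opV_def field_simps)
      ultimately show ?thesis by (simp add: 1)
    qed
  next
    case F: False
    show ?thesis
    proof (cases "J (Suc i)")
      case True
      have "opV i v b c (opU i a b u f) J = (u * v / (b * c) + a / b) * f J + v / c * f (J(i := True, Suc i := False))"
        using True F assms upd by (simp add: opU_def opV_def upd' field_simps)
      moreover have "opU i x c u (opV i v a x f) J = x / c * f J + v / c * f (J(i := True, Suc i := False))"
        using True F assms by (simp add: opU_def opV_def field_simps)
      ultimately show ?thesis by (simp add: 2)
    next
      case False
      then show ?thesis using F by (simp add: opU_def opV_def)
    qed
  qed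
qed

text \<open>The factors overlap in coordinate \<open>Suc i\<close>, where both have a nontrivial
  diagonal entry. Passing one factor through the other rescales the off-diagonal entries by
  \<open>a / b\<close> and \<open>c / d\<close>, and the change of neighbours from \<open>c\<close>
  to \<open>d\<close> and from \<open>b\<close> to \<open>a\<close> absorbs exactly this. No
  T-system relation is involved.\<close>

lemma opU_opV_exchange:
  assumes "b \<noteq> 0" "d \<noteq> (0::'a::field)"
  shows "opV (Suc i) b c d (opU i a b c f) = opU i a b d (opV (Suc i) a c d f)"
proof
  fix J
  show "opV (Suc i) b c d (opU i a b c f) J = opU i a b d (opV (Suc i) a c d f) J"
    by (cases "J i"; cases "J (Suc i)"; cases "J (Suc (Suc i))")
      (use assms in \<open>simp_all add: opU_def opV_def field_simps fun_upd_twist\<close>)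
qed

text \<open>Both matrices fix the basis vector of the shared coordinate \<open>Suc i\<close> and
  only feed into it, so here the order is immaterial with the same parameters on both sides.\<close>

lemma opV_opU_commute:
  "opU (Suc i) a b u (opV i v c d f) = opV i v c d (opU (Suc i) a b u (f::_ \<Rightarrow> 'a::field))"
proof
  fix J
  show "opU (Suc i) a b u (opV i v c d f) J = opV i v c d (opU (Suc i) a b u f) J"
    by (cases "J i"; cases "J (Suc i)"; cases "J (Suc (Suc i))")
      (simp_all add: opU_def opV_def add_divide_distrib distrib_left mult_ac fun_upd_twist)
qed

lemma op_far_commute:
  assumes "i + 2 \<le> l \<or> l + 2 \<le> i"
  shows "opU i a b u (opV l v c d f) = opV l v c d (opU i a b u (f::_ \<Rightarrow> 'a::field))"
    and "opU i a b u (opU l c d v f) = opU l c d v (opU i a b u (f::_ \<Rightarrow> 'a::field))"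
    and "opV i u a b (opV l v c d f) = opV l v c d (opV i u a b (f::_ \<Rightarrow> 'a::field))"
proof -
  have ne: "i \<noteq> l" "i \<noteq> Suc l" "l \<noteq> Suc i" using assms by auto
  have tw: "J(i := p, Suc i := q, l := w, Suc l := z) = J(l := w, Suc l := z, i := p, Suc i := q)"
    for J :: "nat \<Rightarrow> bool" and p q w z using ne by (auto simp: fun_eq_iff)
  show "opU i a b u (opV l v c d f) = opV l v c d (opU i a b u f)"
    by (rule ext) (use ne in \<open>simp add: opU_def opV_def add_divide_distrib distrib_left mult_ac tw\<close>)
  show "opU i a b u (opU l c d v f) = opU l c d v (opU i a b u f)"
    by (rule ext) (use ne in \<open>simp add: opU_def opV_def add_divide_distrib distrib_left mult_ac tw\<close>)
  show "opV i u a b (opV l v c d f) = opV l v c d (opV i u a b f)"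
    by (rule ext) (use ne in \<open>simp add: opU_def opV_def add_divide_distrib distrib_left mult_ac tw\<close>)
qed

text \<open>The set of indices above \<alpha> is upward closed, so it never contains
  \<open>i\<close> without \<open>Suc i\<close>. The off-diagonal term of an ascending step
  therefore reads a zero coefficient.\<close>

lemma opV_highest_weight:
  assumes "\<And>J. J \<noteq> (\<lambda>l. \<alpha> < l) \<Longrightarrow> f J = (0::'a::field)"
  shows "opV i v b c f = (\<lambda>J. (if \<alpha> < i then b / c else 1) * f J)"
proof
  fix J
  have "J(i := True, Suc i := False) \<noteq> (\<lambda>l. \<alpha> < l)"
  proof
    assume "J(i := True, Suc i := False) = (\<lambda>l. \<alpha> < l)"
    then have "(J(i := True, Suc i := False)) i = (\<alpha> < i)" "(J(i := True, Suc i := False)) (Suc i) = (\<alpha> < Suc i)"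
      by simp_all
    then show False by simp
  qed
  then have "f (J(i := True, Suc i := False)) = 0" by (rule assms)
  then show "opV i v b c f J = (if \<alpha> < i then b / c else 1) * f J"
    using assms[of J] by (cases "J = (\<lambda>l. \<alpha> < l)") (simp_all add: opV_def)
qed

text \<open>Dual to the previous lemma: a descending step mixes nothing into the coefficient at an
  upward closed set, whatever the state. Its diagonal entry sits at coordinate \<open>Suc i\<close>,
  hence \<alpha> \<le> \<open>i\<close> instead of \<alpha> < \<open>i\<close>.\<close>

lemma opU_highest_weight:
  "opU i a b u f (\<lambda>l. \<alpha> < l) = (if \<alpha> \<le> i then a / b else 1) * f (\<lambda>l. \<alpha> < (l::nat))"
  by (auto simp: opU_def less_Suc_eq_le)

subsection \<open>Products in the two orders\<close>

text \<open>\<open>p n\<close> means that factor \<open>n + 1\<close> acts before factor \<open>n\<close>. As distant factors commute, the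
  relative orders of neighbouring factors determine the product.\<close>

fun oprod :: "(nat \<Rightarrow> 's \<Rightarrow> 's) \<Rightarrow> (nat \<Rightarrow> bool) \<Rightarrow> nat \<Rightarrow> 's \<Rightarrow> 's" where
  "oprod X p 0 f = f"
| "oprod X p (Suc n) f = (if p n then oprod X p n (X (Suc n) f) else X (Suc n) (oprod X p n f))"

lemma oprod_cong:
  assumes "\<And>i. 1 \<le> i \<Longrightarrow> i \<le> n \<Longrightarrow> X i = X' i" "\<And>i. 1 \<le> i \<Longrightarrow> i < n \<Longrightarrow> p i = p' i"
  shows "oprod X p n = oprod X' p' n"
proof
  fix f
  show "oprod X p n f = oprod X' p' n f" using assms
  proof (induction n arbitrary: f)
    case (Suc n)
    then have IH: "oprod X p n f = oprod X' p' n f" for f by simp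
    have "n = 0 \<or> p n = p' n" using Suc.prems(2)[of n] by auto
    then show ?case using Suc.prems(1)[of "Suc n"] IH by auto
  qed simp
qed

lemma oprod_commute:
  assumes "\<And>i f. 1 \<le> i \<Longrightarrow> i \<le> n \<Longrightarrow> A (X i f) = X i (A f)"
  shows "A (oprod X p n f) = oprod X p n (A f)"
  using assms by (induction n arbitrary: f) auto

definition far_commute :: "(nat \<Rightarrow> 's \<Rightarrow> 's) \<Rightarrow> bool" where
  "far_commute X \<longleftrightarrow> (\<forall>i l f. i + 2 \<le> l \<longrightarrow> X i (X l f) = X l (X i f))"

lemma far_commuteD: "far_commute X \<Longrightarrow> i + 2 \<le> l \<Longrightarrow> X i (X l f) = X l (X i f)"
  unfolding far_commute_def by blast

text \<open>The conditions on \<open>p\<close> say that factor \<open>i\<close> acts after both of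
  its neighbours. It commutes with all other factors, so it can be pulled out to the end;
  \<open>Y\<close> is the family with this factor erased.\<close>

lemma oprod_factor_last:
  assumes "far_commute X" "Y i = id" "\<And>l. l \<noteq> i \<Longrightarrow> Y l = X l"
    and "i \<le> n" "1 \<le> i" "p i" "\<not> p (i - 1)"
  shows "oprod X p n f = X i (oprod Y p n f)"
  using assms(4)
proof (induction n arbitrary: f rule: dec_induct)
  case base
  obtain m where i: "i = Suc m" using assms(5) by (cases i) auto
  have "oprod X p m = oprod Y p m" by (rule oprod_cong) (auto simp: i assms(3))
  then show ?case using assms by (simp add: i)
next
  case (step n)
  show ?case
  proof (cases "n = i")
    case True
    then show ?thesis using assms step by simp
  next
    case False
    then have "X (Suc n) (X i f) = X i (X (Suc n) f)" for f
      using far_commuteD[OF assms(1), of i "Suc n" f] step by simp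
    then show ?thesis using step assms(3)[of "Suc n"] by simp
  qed
qed

lemma oprod_factor_first:
  assumes "far_commute X" "Y i = id" "\<And>l. l \<noteq> i \<Longrightarrow> Y l = X l"
    and "i \<le> n" "1 \<le> i" "\<not> p i" "p (i - 1)"
  shows "oprod X p n f = oprod Y p n (X i f)"
  using assms(4)
proof (induction n arbitrary: f rule: dec_induct)
  case base
  obtain m where i: "i = Suc m" using assms(5) by (cases i) auto
  have "oprod X p m = oprod Y p m" by (rule oprod_cong) (auto simp: i assms(3))
  then show ?case using assms by (simp add: i)
next
  case (step n)
  show ?case
  proof (cases "n = i")
    case True
    then show ?thesis using assms step by simp
  next
    case False
    then have "X (Suc n) (X i f) = X i (X (Suc n) f)" for f
      using far_commuteD[OF assms(1), of i "Suc n" f] step by simp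
    then show ?thesis using step assms(3)[of "Suc n"] by simp
  qed
qed

text \<open>Factor \<open>Suc i\<close> commutes with everything below \<open>i\<close>, so it can
  be moved next to factor \<open>i\<close>, and the local exchange \<open>ex\<close> applies there.
  Factors above \<open>Suc i\<close> are the same on both sides.\<close>

lemma oprod_flip:
  assumes "far_commute X" "far_commute X'" "1 \<le> i" "i < n"
    and X: "\<And>l. l \<noteq> i \<Longrightarrow> l \<noteq> Suc i \<Longrightarrow> X l = X' l"
    and p: "\<And>l. l \<noteq> i \<Longrightarrow> p l = p' l" "p i" "\<not> p' i"
    and ex: "\<And>f. X i (X (Suc i) f) = X' (Suc i) (X' i f)"
  shows "oprod X p n = oprod X' p' n"
proof
  fix f
  have "Suc i \<le> n" using assms by simp
  then show "oprod X p n f = oprod X' p' n f"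
  proof (induction n arbitrary: f rule: dec_induct)
    case base
    obtain m where i: "i = Suc m" using assms(3) by (cases i) auto
    have *: "oprod X p m = oprod X' p' m" by (rule oprod_cong) (use i X p in auto)
    have 1: "X' (Suc i) (oprod X' p' m f) = oprod X' p' m (X' (Suc i) f)" for f
      by (rule oprod_commute) (rule far_commuteD[OF assms(2), symmetric], simp add: i)
    have 2: "X (Suc i) (oprod X p m f) = oprod X p m (X (Suc i) f)" for f
      by (rule oprod_commute) (rule far_commuteD[OF assms(1), symmetric], simp add: i)
    have pm: "p m = p' m" using p(1)[of m] i by simp
    show ?case
    proof (cases "p m")
      case True
      have "oprod X p (Suc i) f = oprod X p m (X i (X (Suc i) f))"
        using True p(2) by (simp add: i)
      also have "\<dots> = X' (Suc i) (oprod X' p' m (X' i f))"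
        by (simp add: ex * 1)
      also have "\<dots> = oprod X' p' (Suc i) f"
        using True pm p(3) by (simp add: i)
      finally show ?thesis .
    next
      case False
      have "oprod X p (Suc i) f = X i (oprod X p m (X (Suc i) f))"
        using False p(2) by (simp add: i)
      also have "\<dots> = X' (Suc i) (X' i (oprod X' p' m f))"
        unfolding 2[symmetric] ex unfolding * ..
      also have "\<dots> = oprod X' p' (Suc i) f"
        using False pm p(3) by (simp add: i)
      finally show ?thesis .
    qed
  next
    case (step n)
    then show ?case using X[of "Suc n"] p(1)[of n] by simp
  qed
qed

subsection \<open>Strips of a stepped surface\<close>

text \<open>Row \<open>i\<close> moves from column \<open>j\<close> to \<open>j + 1\<close> and
  reads the neighbouring rows where they currently stand: row \<open>i - 1\<close> is still in
  column \<open>j\<close> if \<open>p (i - 1)\<close>, and row \<open>i + 1\<close> has already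
  reached \<open>j + 1\<close> if \<open>p i\<close>.\<close>

definition row_op :: "(nat \<Rightarrow> int \<Rightarrow> int) \<Rightarrow> (nat \<Rightarrow> int \<Rightarrow> 'a::field) \<Rightarrow> (nat \<Rightarrow> bool) \<Rightarrow> int \<Rightarrow> nat \<Rightarrow>
    ((nat \<Rightarrow> bool) \<Rightarrow> 'a) \<Rightarrow> (nat \<Rightarrow> bool) \<Rightarrow> 'a" where
  "row_op S t p j i = (if S i j < S i (j + 1)
     then opV i (t (i - 1) (if p (i - 1) then j else j + 1)) (t i j) (t i (j + 1))
     else opU i (t i j) (t i (j + 1)) (t (i + 1) (if p i then j + 1 else j)))"

definition valid_order :: "nat \<Rightarrow> (nat \<Rightarrow> int \<Rightarrow> int) \<Rightarrow> int \<Rightarrow> (nat \<Rightarrow> bool) \<Rightarrow> bool" where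
  "valid_order r S j p \<longleftrightarrow> (\<forall>i. 1 \<le> i \<and> i < r \<longrightarrow>
     (if p i then S (i + 1) (j + 1) = S i j else S i (j + 1) = S (i + 1) j))"

text \<open>An order is valid if, whenever a row advances from column \<open>j\<close> to \<open>j + 1\<close>, the current
  points of adjacent rows are at distance one on the surface; \<open>p i\<close> then selects the diagonal of
  the square between rows \<open>i\<close> and \<open>i + 1\<close>.\<close>

definition diag_order :: "(nat \<Rightarrow> int \<Rightarrow> int) \<Rightarrow> int \<Rightarrow> nat \<Rightarrow> bool" where
  "diag_order S j i \<longleftrightarrow> S (i + 1) (j + 1) = S i j"

definition strip :: "nat \<Rightarrow> (nat \<Rightarrow> int \<Rightarrow> int) \<Rightarrow> (nat \<Rightarrow> int \<Rightarrow> 'a::field) \<Rightarrow> int \<Rightarrow>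
    ((nat \<Rightarrow> bool) \<Rightarrow> 'a) \<Rightarrow> (nat \<Rightarrow> bool) \<Rightarrow> 'a" where
  "strip r S t j = oprod (row_op S t (diag_order S j) j) (diag_order S j) r"

definition weights :: "nat \<Rightarrow> (nat \<Rightarrow> int \<Rightarrow> 'a::field) \<Rightarrow> bool" where
  "weights r t \<longleftrightarrow> (\<forall>i j. t i j \<noteq> 0) \<and> (\<forall>j. t 0 j = 1) \<and> (\<forall>j. t (r + 1) j = 1)"

lemma stepped_rowD:
  assumes "stepped_surface r S" "1 \<le> i" "i \<le> r"
  shows "\<bar>S i (j + 1) - S i j\<bar> = 1" "even (int i + j + S i j)"
    "i < r \<Longrightarrow> \<bar>S (i + 1) j - S i j\<bar> = 1"
  using assms unfolding stepped_surface_def by blast+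

text \<open>In a unit square of a stepped surface at least one diagonal is level: if the ends of one
  differ, they differ by 2, and both other corners have the height in between.\<close>

lemma valid_diag_order:
  assumes "stepped_surface r S"
  shows "valid_order r S j (diag_order S j)"
proof -
  have "S i (j + 1) = S (i + 1) j" if "1 \<le> i" "i < r" "S (i + 1) (j + 1) \<noteq> S i j" for i
    using stepped_rowD(1)[OF assms, of i j] stepped_rowD(1)[OF assms, of "i + 1" j]
      stepped_rowD(3)[OF assms, of i j] stepped_rowD(3)[OF assms, of i "j + 1"] that
    by linarith
  then show ?thesis by (auto simp: valid_order_def diag_order_def)
qed

lemma far_commute_row_op: "far_commute (row_op S t p j)"
  unfolding far_commute_def row_op_def by (auto simp: op_far_commute)

text \<open>If both orders are valid at \<open>m\<close>, both diagonals of the square are level, so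
  one of the rows \<open>m\<close>, \<open>m + 1\<close> ascends and the other descends. Depending
  on which, the factors commute outright or exchange with altered neighbours.\<close>

lemma oprod_row_op_flip:
  assumes S: "stepped_surface r S" and t: "\<And>i j. t i j \<noteq> 0"
    and v: "valid_order r S j p" "valid_order r S j p'"
    and m: "1 \<le> m" "m < r" "p m" "\<not> p' m" "\<And>l. l \<noteq> m \<Longrightarrow> p l = p' l"
  shows "oprod (row_op S t p j) p r = oprod (row_op S t p' j) p' r"
proof (rule oprod_flip[where i = m])
  show "row_op S t p j l = row_op S t p' j l" if "l \<noteq> m" "l \<noteq> Suc m" for l
  proof (cases l)
    case 0
    then show ?thesis using that m(5)[of l] by (simp add: row_op_def)
  next
    case (Suc l')
    then show ?thesis using that m(5)[of l] m(5)[of l'] by (simp add: row_op_def)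
  qed
  have e: "S (m + 1) (j + 1) = S m j" "S m (j + 1) = S (m + 1) j"
    using v m unfolding valid_order_def by (metis)+
  show "row_op S t p j m (row_op S t p j (Suc m) f) = row_op S t p' j (Suc m) (row_op S t p' j m f)" for f
  proof (cases "S m j < S m (j + 1)")
    case True
    then have 1: "row_op S t p j m = opV m (t (m - 1) (if p (m - 1) then j else j + 1)) (t m j) (t m (j + 1))"
      "row_op S t p' j m = opV m (t (m - 1) (if p (m - 1) then j else j + 1)) (t m j) (t m (j + 1))"
      using m(5)[of "m - 1"] m(1) by (auto simp: row_op_def)
    have 2: "row_op S t p j (Suc m) = opU (Suc m) (t (m + 1) j) (t (m + 1) (j + 1)) (t (m + 2) (if p (m + 1) then j + 1 else j))"
      "row_op S t p' j (Suc m) = opU (Suc m) (t (m + 1) j) (t (m + 1) (j + 1)) (t (m + 2) (if p (m + 1) then j + 1 else j))"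
      using m(5)[of "m + 1"] e True by (auto simp: row_op_def)
    show ?thesis unfolding 1 2 by (rule opV_opU_commute[symmetric])
  next
    case False
    then have F: "S m (j + 1) < S m j" using stepped_rowD(1)[OF S, of m j] m by linarith
    then show ?thesis using e m(3,4) by (simp add: row_op_def opU_opV_exchange t)
  qed
qed (use m far_commute_row_op in auto)

text \<open>The order \<open>q m\<close> follows \<open>diag_order\<close> below \<open>m\<close>
  and \<open>p\<close> from \<open>m\<close> on. Passing from \<open>p\<close> to
  \<open>diag_order\<close> changes one position at a time, and where the orders differ both are
  valid, so a flip applies.\<close>

lemma strip_any_order:
  assumes S: "stepped_surface r S" and t: "weights r t" and v: "valid_order r S j p"
  shows "oprod (row_op S t p j) p r = strip r S t j"
proof -
  define q where "q = (\<lambda>m i. if i < m then diag_order S j i else p i)"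
  have vq: "valid_order r S j (q m)" for m
    using v valid_diag_order[OF S, of j] by (auto simp: valid_order_def q_def)
  have nz: "t i j \<noteq> 0" for i j using t by (simp add: weights_def)
  \<comment> \<open>Position 0 only selects the column in which row 0 is read, and row 0 is
    constantly 1. Position \<open>r\<close> is treated in the same way at the end, through row
    \<open>r + 1\<close>.\<close>
  have low: "oprod (row_op S t (q 0) j) (q 0) r = oprod (row_op S t (q 1) j) (q 1) r"
  proof (rule oprod_cong)
    fix i :: nat assume i: "1 \<le> i" "i \<le> r"
    have "t 0 a = 1" for a
      using t by (simp add: weights_def)
    then show "row_op S t (q 0) j i = row_op S t (q 1) j i"
      using i by (cases "i - 1 = 0") (auto simp: row_op_def q_def)
  qed (auto simp: q_def)
  have step: "oprod (row_op S t (q m) j) (q m) r = oprod (row_op S t (q (Suc m)) j) (q (Suc m)) r"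
    if "m < r" for m
  proof (cases "m = 0 \<or> p m = diag_order S j m")
    case True
    have "q m = q (Suc m)" if "p m = diag_order S j m"
      using that by (auto simp: q_def fun_eq_iff less_Suc_eq)
    then show ?thesis using True low by auto
  next
    case False
    have *: "q m l = q (Suc m) l" if "l \<noteq> m" for l using that by (auto simp: q_def)
    show ?thesis
    proof (cases "p m")
      case True
      show ?thesis by (rule oprod_row_op_flip[OF S nz vq vq, of m]) (use * True False that in \<open>auto simp: q_def\<close>)
    next
      case np: False
      show ?thesis
        by (rule oprod_row_op_flip[OF S nz vq vq, of m, symmetric]) (use * np False that in \<open>auto simp: q_def\<close>)
    qed
  qed
  have "oprod (row_op S t (q 0) j) (q 0) r = oprod (row_op S t (q m) j) (q m) r" if "m \<le> r" for m
    using that by (induction m) (auto simp: step)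
  from this[of r] have "oprod (row_op S t p j) p r = oprod (row_op S t (q r) j) (q r) r"
    by (simp add: q_def)
  also have "\<dots> = strip r S t j"
    unfolding strip_def
  proof (rule oprod_cong)
    fix i :: nat assume i: "1 \<le> i" "i \<le> r"
    have "t (Suc r) a = 1" for a
      using t by (simp add: weights_def)
    then show "row_op S t (q r) j i = row_op S t (diag_order S j) j i"
      using i by (cases "i = r") (auto simp: row_op_def q_def)
  qed (auto simp: q_def)
  finally show ?thesis .
qed

lemma strip_mutation:
  assumes L: "stepped_surface r L" and H: "stepped_surface r H"
    and t: "weights r t" and t': "weights r t'" and i: "1 \<le> i" "i \<le> r"
    and HL: "\<And>l m. (l, m) \<noteq> (i, j) \<Longrightarrow> H l m = L l m" "H i j = L i j + 2"
    and tt': "\<And>l m. (l, m) \<noteq> (i, j) \<Longrightarrow> t' l m = t l m"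
    and rel: "t' i j * t i j = t (i + 1) j * t (i - 1) j + t i (j - 1) * t i (j + 1)"
  shows "strip r L t j (strip r L t (j - 1) f) = strip r H t' j (strip r H t' (j - 1) f)"
proof -
  \<comment> \<open>Since both \<open>L\<close> and \<open>H\<close> are stepped, each neighbour is
    at distance 1 from two heights that differ by 2, hence lies midway: the vertex is a local
    minimum of \<open>L\<close>.\<close>
  have nb: "L i (j - 1) = L i j + 1" "L i (j + 1) = L i j + 1"
    "i < r \<Longrightarrow> L (i + 1) j = L i j + 1" "1 < i \<Longrightarrow> L (i - 1) j = L i j + 1"
  proof -
    show "L i (j - 1) = L i j + 1"
      using stepped_rowD(1)[OF L i, of "j - 1"] stepped_rowD(1)[OF H i, of "j - 1"] HL(1)[of i "j - 1"] HL(2)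
      by simp
    show "L i (j + 1) = L i j + 1"
      using stepped_rowD(1)[OF L i, of j] stepped_rowD(1)[OF H i, of j] HL(1)[of i "j + 1"] HL(2)
      by simp
    show "L (i + 1) j = L i j + 1" if "i < r"
      using stepped_rowD(3)[OF L i that, of j] stepped_rowD(3)[OF H i that, of j] HL(1)[of "i + 1" j] HL(2)
      by simp
    show "L (i - 1) j = L i j + 1" if "1 < i"
      using stepped_rowD(3)[OF L, of "i - 1" j] stepped_rowD(3)[OF H, of "i - 1" j] HL(1)[of "i - 1" j] HL(2) that i
      by (cases i) auto
  qed
  \<comment> \<open>In strip \<open>j - 1\<close> row \<open>i\<close> can be processed last and in strip \<open>j\<close> it can be processed
     first, so the two operators touching the vertex \<open>(i, j)\<close> become adjacent.\<close>
  define p where "p = (diag_order L (j - 1))(i := True, i - 1 := False)"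
  define q where "q = (diag_order L j)(i := False, i - 1 := True)"
  have pi: "p i" "\<not> p (i - 1)" "\<not> q i" "q (i - 1)" using i by (auto simp: p_def q_def)
  have pl: "p l = diag_order L (j - 1) l" "q l = diag_order L j l" if "l \<noteq> i" "Suc l \<noteq> i" for l
    using that i by (auto simp: p_def q_def)
  have vL: "valid_order r L (j - 1) p" "valid_order r L j q"
  proof -
    have "if p l then L (l + 1) (j - 1 + 1) = L l (j - 1) else L l (j - 1 + 1) = L (l + 1) (j - 1)"
      if "1 \<le> l" "l < r" for l
    proof -
      consider "l = i" | "Suc l = i" | "l \<noteq> i" "Suc l \<noteq> i" by blast
      then show ?thesis
      proof cases
        case 3
        then show ?thesis using pl valid_diag_order[OF L, of "j - 1", unfolded valid_order_def, rule_format, of l] that by simp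
      qed (use pi nb that in auto)
    qed
    then show "valid_order r L (j - 1) p" unfolding valid_order_def by blast
    have "if q l then L (l + 1) (j + 1) = L l j else L l (j + 1) = L (l + 1) j"
      if "1 \<le> l" "l < r" for l
    proof -
      consider "l = i" | "Suc l = i" | "l \<noteq> i" "Suc l \<noteq> i" by blast
      then show ?thesis
      proof cases
        case 3
        then show ?thesis using pl valid_diag_order[OF L, of j, unfolded valid_order_def, rule_format, of l] that by simp
      qed (use pi nb that in auto)
    qed
    then show "valid_order r L j q" unfolding valid_order_def by blast
  qed
  have vH: "valid_order r H (j - 1) p" "valid_order r H j q"
  proof -
    have "if p l then H (l + 1) (j - 1 + 1) = H l (j - 1) else H l (j - 1 + 1) = H (l + 1) (j - 1)"
      if "1 \<le> l" "l < r" for l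
    proof -
      consider "l = i" | "Suc l = i" | "l \<noteq> i" "Suc l \<noteq> i" by blast
      then show ?thesis
        using vL(1) that pi by cases (auto simp: valid_order_def HL(1))
    qed
    then show "valid_order r H (j - 1) p" unfolding valid_order_def by blast
    have "if q l then H (l + 1) (j + 1) = H l j else H l (j + 1) = H (l + 1) j"
      if "1 \<le> l" "l < r" for l
    proof -
      consider "l = i" | "Suc l = i" | "l \<noteq> i" "Suc l \<noteq> i" by blast
      then show ?thesis
        using vL(2) that pi by cases (auto simp: valid_order_def HL(1))
    qed
    then show "valid_order r H j q" unfolding valid_order_def by blast
  qed
  define Y where "Y = (row_op L t p (j - 1))(i := id)"
  define Z where "Z = (row_op L t q j)(i := id)"
  have Y: "Y i = id" "\<And>l. l \<noteq> i \<Longrightarrow> Y l = row_op L t p (j - 1) l"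
    and Z: "Z i = id" "\<And>l. l \<noteq> i \<Longrightarrow> Z l = row_op L t q j l"
    by (auto simp: Y_def Z_def)
  \<comment> \<open>With these orders the adjacent rows read row \<open>i\<close> in column
    \<open>j - 1\<close> during the first strip and in column \<open>j + 1\<close> during the
    second, never at the changed vertex. The remaining factors thus agree for \<open>L\<close> and
    \<open>H\<close>.\<close>
  have Y': "Y l = row_op H t' p (j - 1) l" if "l \<noteq> i" for l
  proof -
    consider "Suc l = i" | "l - 1 = i" | "Suc l \<noteq> i" "l - 1 \<noteq> i" by blast
    then show ?thesis
      using that pi by cases (auto simp: Y row_op_def HL(1) tt')
  qed
  have Z': "Z l = row_op H t' q j l" if "l \<noteq> i" for l
  proof -
    consider "Suc l = i" | "l - 1 = i" | "Suc l \<noteq> i" "l - 1 \<noteq> i" by blast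
    then show ?thesis
      using that pi by cases (auto simp: Z row_op_def HL(1) tt')
  qed
  have sL: "strip r L t (j - 1) f = row_op L t p (j - 1) i (oprod Y p r f)"
    "strip r L t j f = oprod Z q r (row_op L t q j i f)" for f
    subgoal unfolding strip_any_order[OF L t vL(1), symmetric]
      by (rule oprod_factor_last) (use i pi Y Z far_commute_row_op in auto)
    subgoal unfolding strip_any_order[OF L t vL(2), symmetric]
      by (rule oprod_factor_first) (use i pi Y Z far_commute_row_op in auto)
    done
  have sH: "strip r H t' (j - 1) f = row_op H t' p (j - 1) i (oprod Y p r f)"
    "strip r H t' j f = oprod Z q r (row_op H t' q j i f)" for f
    subgoal unfolding strip_any_order[OF H t' vH(1), symmetric]
      by (rule oprod_factor_last) (use i pi Y(1) Y' Z(1) Z' far_commute_row_op in auto)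
    subgoal unfolding strip_any_order[OF H t' vH(2), symmetric]
      by (rule oprod_factor_first) (use i pi Y(1) Y' Z(1) Z' far_commute_row_op in auto)
    done
  have r1: "row_op L t p (j - 1) i = opU i (t i (j - 1)) (t i j) (t (i + 1) j)"
    "row_op L t q j i = opV i (t (i - 1) j) (t i j) (t i (j + 1))"
    using pi nb by (auto simp: row_op_def)
  have r2: "row_op H t' p (j - 1) i = opV i (t (i - 1) j) (t i (j - 1)) (t' i j)"
    "row_op H t' q j i = opU i (t' i j) (t i (j + 1)) (t (i + 1) j)"
    using pi nb HL tt' i by (auto simp: row_op_def)
  have "opV i (t (i - 1) j) (t i j) (t i (j + 1)) (opU i (t i (j - 1)) (t i j) (t (i + 1) j) g)
      = opU i (t' i j) (t i (j + 1)) (t (i + 1) j) (opV i (t (i - 1) j) (t i (j - 1)) (t' i j) g)" for g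
    by (rule opU_opV_mutation) (use t t' rel in \<open>auto simp: weights_def\<close>)
  then show ?thesis by (simp add: sL sH r1 r2)
qed

lemma strip_cong:
  assumes "\<And>l. S l j = S' l j" "\<And>l. S l (j + 1) = S' l (j + 1)"
    "\<And>l. t l j = t' l j" "\<And>l. t l (j + 1) = t' l (j + 1)"
  shows "strip r S t j = strip r S' t' j"
proof -
  have "diag_order S j = diag_order S' j"
    by (simp add: fun_eq_iff diag_order_def assms)
  moreover have "row_op S t p j = row_op S' t' p j" for p
    by (rule ext) (simp add: row_op_def assms)
  ultimately show ?thesis by (simp add: strip_def)
qed

section \<open>Products of consecutive strips and their invariance under raising the surface\<close>

fun strips :: "nat \<Rightarrow> (nat \<Rightarrow> int \<Rightarrow> int) \<Rightarrow> (nat \<Rightarrow> int \<Rightarrow> 'a::field) \<Rightarrow> int \<Rightarrow> nat \<Rightarrow>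
    ((nat \<Rightarrow> bool) \<Rightarrow> 'a) \<Rightarrow> (nat \<Rightarrow> bool) \<Rightarrow> 'a" where
  "strips r S t j 0 f = f"
| "strips r S t j (Suc n) f = strip r S t (j + int n) (strips r S t j n f)"

lemma strips_cong:
  assumes "\<And>l m. m \<le> j + int n \<Longrightarrow> S l m = S' l m" "\<And>l m. m \<le> j + int n \<Longrightarrow> t l m = t' l m"
  shows "strips r S t j n f = strips r S' t' j n f"
  using assms
proof (induction n)
  case (Suc n)
  have "strip r S t (j + int n) = strip r S' t' (j + int n)"
    by (rule strip_cong) (simp_all add: Suc.prems)
  then show ?case using Suc by simp
qed simp

lemma strips_mutation:
  assumes L: "stepped_surface r L" and H: "stepped_surface r H"
    and t: "weights r t" and t': "weights r t'" and i: "1 \<le> i" "i \<le> r"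
    and HL: "\<And>l m. (l, m) \<noteq> (i, j) \<Longrightarrow> H l m = L l m" "H i j = L i j + 2"
    and tt': "\<And>l m. (l, m) \<noteq> (i, j) \<Longrightarrow> t' l m = t l m"
    and rel: "t' i j * t i j = t (i + 1) j * t (i - 1) j + t i (j - 1) * t i (j + 1)"
    and j: "j0 < j" "j < j0 + int n"
  shows "strips r L t j0 n f = strips r H t' j0 n f"
proof -
  \<comment> \<open>The number of strips to the left of strip \<open>j - 1\<close>; the two strips
    that meet column \<open>j\<close> complete the first \<open>k + 2\<close> ones.\<close>
  define k where "k = nat (j - j0 - 1)"
  have jk: "j = j0 + int k + 1" using j by (simp add: k_def)
  have "k + 2 \<le> n" using j jk by simp
  then show ?thesis
  proof (induction n rule: dec_induct)
    case base
    have "strips r L t j0 k f = strips r H t' j0 k f"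
      by (rule strips_cong) (use jk HL tt' in auto)
    moreover have "strips r L t j0 (k + 2) f = strip r L t j (strip r L t (j - 1) (strips r L t j0 k f))"
      "strips r H t' j0 (k + 2) f = strip r H t' j (strip r H t' (j - 1) (strips r H t' j0 k f))"
      by (simp_all add: jk numeral_2_eq_2 add_ac)
    ultimately show ?case using strip_mutation[OF L H t t' i HL tt' rel] by simp
  next
    case (step n)
    have "strip r L t (j0 + int n) = strip r H t' (j0 + int n)"
      by (rule strip_cong) (use step jk HL tt' in auto)
    then show ?case using step by simp
  qed
qed

lemma lower_local_max:
  assumes S: "stepped_surface r S" and i: "1 \<le> i" "i \<le> r"
    and nb: "S i (j - 1) = S i j - 1" "S i (j + 1) = S i j - 1"
      "i < r \<Longrightarrow> S (i + 1) j = S i j - 1" "1 < i \<Longrightarrow> S (i - 1) j = S i j - 1"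
  shows "stepped_surface r (S(i := (S i)(j := S i j - 2)))"
proof -
  let ?L = "S(i := (S i)(j := S i j - 2))"
  have "even (int a + m + ?L a m)" if "1 \<le> a" "a \<le> r" for a m
    using stepped_rowD(2)[OF S that, of m] by auto
  moreover have "\<bar>?L (a + 1) m - ?L a m\<bar> = 1" if "1 \<le> a" "a < r" for a m
    using stepped_rowD(3)[OF S that(1) _ that(2), of m] nb that by auto
  moreover have "\<bar>?L a (m + 1) - ?L a m\<bar> = 1" if "1 \<le> a" "a \<le> r" for a m
  proof -
    consider "a = i \<and> m = j" | "a = i \<and> m + 1 = j" | "a \<noteq> i \<or> (m \<noteq> j \<and> m + 1 \<noteq> j)" by blast
    then show ?thesis
      by cases (use stepped_rowD(1)[OF S that, of m] nb in auto)
  qed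
  ultimately show ?thesis by (simp add: stepped_surface_def)
qed

text \<open>Induction on the total height of \<open>S\<close> above \<open>s\<close>. A highest
  point among those where the surfaces differ is a local maximum of \<open>S\<close>; by parity it
  lies at least 2 above \<open>s\<close>, so lowering it by 2 stays above \<open>s\<close> and is an
  inverse mutation.\<close>

lemma strips_invariant:
  fixes T :: "nat \<Rightarrow> int \<Rightarrow> int \<Rightarrow> 'a::field"
  assumes s: "stepped_surface r s"
    and T: "\<And>i j k. T i j k \<noteq> 0" "\<And>j k. T 0 j k = 1" "\<And>j k. T (r + 1) j k = 1"
    and rel: "\<And>i j k. 1 \<le> i \<Longrightarrow> i \<le> r \<Longrightarrow> odd (int i + j + k) \<Longrightarrow> s i j < k \<Longrightarrow> j0 < j \<Longrightarrow> j < j0 + int n \<Longrightarrow>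
      T i j (k + 1) * T i j (k - 1) = T i (j + 1) k * T i (j - 1) k + T (i + 1) j k * T (i - 1) j k"
    and "stepped_surface r S"
    and "\<And>i j. s i j \<le> S i j"
    and "\<And>i j. S i j \<noteq> s i j \<Longrightarrow> 1 \<le> i \<and> i \<le> r \<and> j0 < j \<and> j < j0 + int n"
  shows "strips r S (\<lambda>i j. T i j (S i j)) j0 n f = strips r s (\<lambda>i j. T i j (s i j)) j0 n f"
  using assms(6-8)
proof (induction "\<Sum>(i, j)\<in>{1..r} \<times> {j0..j0 + int n}. nat (S i j - s i j)" arbitrary: S rule: less_induct)
  case (less S)
  note S = less.prems(1) and ge = less.prems(2) and off = less.prems(3)
  define D where "D = {(i, j). S i j \<noteq> s i j}"
  have D: "D \<subseteq> {1..r} \<times> {j0..j0 + int n}" using off by (force simp: D_def)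
  show ?case
  proof (cases "D = {}")
    case True
    then have "S = s" by (auto simp: D_def fun_eq_iff)
    then show ?thesis by simp
  next
    case False
    have "finite D" using D by (rule finite_subset) auto
    then obtain x where x: "x \<in> D" "\<And>y. y \<in> D \<Longrightarrow> (case y of (l, m) \<Rightarrow> S l m) \<le> (case x of (l, m) \<Rightarrow> S l m)"
      using False obtains_MAX[of D "\<lambda>(l, m). S l m"] Max_ge[of "(\<lambda>(l, m). S l m) ` D"]
      by (metis finite_imageI imageI)
    obtain i j where xij: "x = (i, j)" by (cases x)
    have ne: "S i j \<noteq> s i j" and mx: "\<And>l m. S l m \<noteq> s l m \<Longrightarrow> S l m \<le> S i j"
      using x xij by (force simp: D_def)+
    have i: "1 \<le> i" "i \<le> r" and j: "j0 < j" "j < j0 + int n" using off[OF ne] by auto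
    have lt: "s i j < S i j" using ge[of i j] ne by simp
    have par: "even (int i + j + S i j)" "even (int i + j + s i j)"
      using stepped_rowD(2) S s i by blast+
    have lt2: "s i j \<le> S i j - 2"
    proof -
      have "s i j \<noteq> S i j - 1" using par by auto
      then show ?thesis using lt by simp
    qed
    \<comment> \<open>A neighbour one higher than the chosen maximum would have to lie on
      \<open>s\<close>, but \<open>s\<close> cannot climb that far in one step from its lower value
      at \<open>(i, j)\<close>.\<close>
    have down: "S l m = S i j - 1" if "\<bar>S l m - S i j\<bar> = 1" "\<bar>s l m - s i j\<bar> = 1" for l m
      using mx[of l m] that lt by linarith
    have nb: "S i (j - 1) = S i j - 1" "S i (j + 1) = S i j - 1"
      "i < r \<Longrightarrow> S (i + 1) j = S i j - 1" "1 < i \<Longrightarrow> S (i - 1) j = S i j - 1"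
    proof -
      show "S i (j - 1) = S i j - 1"
        using stepped_rowD(1)[OF S i, of "j - 1"] stepped_rowD(1)[OF s i, of "j - 1"] by (intro down) auto
      show "S i (j + 1) = S i j - 1"
        using stepped_rowD(1)[OF S i, of j] stepped_rowD(1)[OF s i, of j] by (intro down) auto
      show "S (i + 1) j = S i j - 1" if "i < r"
        using stepped_rowD(3)[OF S i that, of j] stepped_rowD(3)[OF s i that, of j] by (intro down) auto
      show "S (i - 1) j = S i j - 1" if "1 < i"
        using stepped_rowD(3)[OF S, of "i - 1" j] stepped_rowD(3)[OF s, of "i - 1" j] that i
        by (intro down) (cases i; auto)+
    qed
    define L where "L = S(i := (S i)(j := S i j - 2))"
    have L: "stepped_surface r L" unfolding L_def by (rule lower_local_max[OF S i nb])
    have Lij: "L i j = S i j - 2" and Lne: "\<And>l m. (l, m) \<noteq> (i, j) \<Longrightarrow> L l m = S l m"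
      by (auto simp: L_def)
    have geL: "s l m \<le> L l m" for l m
      using ge[of l m] lt2 Lij Lne[of l m] by (cases "(l, m) = (i, j)") auto
    have offL: "1 \<le> l \<and> l \<le> r \<and> j0 < m \<and> m < j0 + int n" if "L l m \<noteq> s l m" for l m
      using that off[of l m] Lne[of l m] i j by (cases "(l, m) = (i, j)") auto
    have "(\<Sum>(i, j)\<in>{1..r} \<times> {j0..j0 + int n}. nat (L i j - s i j))
        < (\<Sum>(i, j)\<in>{1..r} \<times> {j0..j0 + int n}. nat (S i j - s i j))"
    proof (rule sum_strict_mono_ex1)
      show "\<forall>x\<in>{1..r} \<times> {j0..j0 + int n}. (case x of (i, j) \<Rightarrow> nat (L i j - s i j)) \<le> (case x of (i, j) \<Rightarrow> nat (S i j - s i j))"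
        by (auto simp: L_def)
      show "\<exists>x\<in>{1..r} \<times> {j0..j0 + int n}. (case x of (i, j) \<Rightarrow> nat (L i j - s i j)) < (case x of (i, j) \<Rightarrow> nat (S i j - s i j))"
        by (rule bexI[of _ "(i, j)"]) (use i j lt Lij in auto)
    qed auto
    then have IH: "strips r L (\<lambda>i j. T i j (L i j)) j0 n f = strips r s (\<lambda>i j. T i j (s i j)) j0 n f"
      by (rule less.hyps) (use L geL offL in auto)
    have "strips r L (\<lambda>i j. T i j (L i j)) j0 n f = strips r S (\<lambda>i j. T i j (S i j)) j0 n f"
    proof (rule strips_mutation[OF L S _ _ i _ _ _ _ j])
      show "weights r (\<lambda>i j. T i j (L i j))" "weights r (\<lambda>i j. T i j (S i j))"
        using T by (auto simp: weights_def)
      let ?k = "S i j - 1"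
      have R: "T i j (S i j) * T i j (S i j - 2) =
          T i (j + 1) ?k * T i (j - 1) ?k + T (i + 1) j ?k * T (i - 1) j ?k"
        using rel[of i j ?k] i j lt2 par by simp
      \<comment> \<open>In the boundary rows the height of the surface is unconstrained, but the
        value is 1 at every height.\<close>
      have "T (i + 1) j (L (i + 1) j) = T (i + 1) j ?k"
        using nb(3) i T(3) Lne by (cases "i = r") auto
      moreover have "T (i - 1) j (L (i - 1) j) = T (i - 1) j ?k"
        using nb(4) i T(2) Lne by (cases "i = 1") auto
      moreover have "L i (j - 1) = ?k" "L i (j + 1) = ?k" using nb Lne by auto
      ultimately show "T i j (S i j) * T i j (L i j) =
          T (i + 1) j (L (i + 1) j) * T (i - 1) j (L (i - 1) j) +
          T i (j - 1) (L i (j - 1)) * T i (j + 1) (L i (j + 1))"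
        by (simp only: Lij R) (simp only: add.commute mult.commute)
    qed (use Lij Lne in auto)
    then show ?thesis using IH by simp
  qed
qed

subsection \<open>Evaluation on a mountain\<close>

lemma oprod_scale:
  assumes X: "\<And>i g. 1 \<le> i \<Longrightarrow> i \<le> n \<Longrightarrow> (\<And>J. J \<noteq> I \<Longrightarrow> g J = (0::'a::field)) \<Longrightarrow> X i g = (\<lambda>J. c i * g J)"
    and f: "\<And>J. J \<noteq> I \<Longrightarrow> f J = 0"
  shows "oprod X p n f = (\<lambda>J. (\<Prod>i=1..n. c i) * f J)"
  using assms
proof (induction n arbitrary: f)
  case (Suc n)
  have IH: "oprod X p n g = (\<lambda>J. (\<Prod>i=1..n. c i) * g J)" if "\<And>J. J \<noteq> I \<Longrightarrow> g J = 0" for g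
    using Suc.IH[of g] Suc.prems(1) that by simp
  have X: "X (Suc n) g = (\<lambda>J. c (Suc n) * g J)" if "\<And>J. J \<noteq> I \<Longrightarrow> g J = 0" for g
    using Suc.prems(1)[of "Suc n" g] that by simp
  show ?case using Suc.prems(2) by (simp add: IH X mult_ac)
qed simp

lemma oprod_scale_at:
  assumes X: "\<And>i g. 1 \<le> i \<Longrightarrow> i \<le> n \<Longrightarrow> X i g I = c i * g I"
  shows "oprod X p n f I = (\<Prod>i=1..n. c i) * (f I :: 'a::field)"
  using assms by (induction n arbitrary: f) (simp_all add: mult_ac)

text \<open>The initial basis state is an eigenvector of every ascending strip, and the eigenvalues
  telescope from column to column. \<open>strips_descending\<close> is the dual statement for a
  single coefficient.\<close>

lemma strips_ascending:
  assumes t: "weights r t" and f: "\<And>J. J \<noteq> (\<lambda>l. \<alpha> < l) \<Longrightarrow> f J = 0"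
    and asc: "\<And>i m. 1 \<le> i \<Longrightarrow> i \<le> r \<Longrightarrow> j \<le> m \<Longrightarrow> m < j + int n \<Longrightarrow> S i m < S i (m + 1)"
  shows "strips r S t j n f = (\<lambda>J. (\<Prod>i=1..r. if \<alpha> < i then t i j / t i (j + int n) else 1) * f J)"
  using asc
proof (induction n)
  case 0
  have "(if \<alpha> < i then t i j / t i (j + int 0) else 1) = 1" for i
    using t by (simp add: weights_def)
  then show ?case by (simp only: prod.neutral_const strips.simps mult_1_left)
next
  case (Suc n)
  let ?g = "\<lambda>J. (\<Prod>i=1..r. if \<alpha> < i then t i j / t i (j + int n) else 1) * f J"
  have "strips r S t j (Suc n) f = strip r S t (j + int n) ?g"
    using Suc by simp
  also have "\<dots> = (\<lambda>J. (\<Prod>i=1..r. if \<alpha> < i then t i (j + int n) / t i (j + int n + 1) else 1) * ?g J)"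
    unfolding strip_def
    by (rule oprod_scale[where I = "\<lambda>l. \<alpha> < l"]) (use Suc.prems f in \<open>auto simp: row_op_def opV_highest_weight\<close>)
  also have "\<dots> = (\<lambda>J. (\<Prod>i=1..r. if \<alpha> < i then t i j / t i (j + int (Suc n)) else 1) * f J)"
  proof -
    have "(\<Prod>i=1..r. if \<alpha> < i then t i (j + int n) / t i (j + int n + 1) else 1) *
        (\<Prod>i=1..r. if \<alpha> < i then t i j / t i (j + int n) else 1)
        = (\<Prod>i=1..r. if \<alpha> < i then t i j / t i (j + int (Suc n)) else 1)"
      unfolding prod.distrib[symmetric]
      by (rule prod.cong) (use t in \<open>auto simp: weights_def field_simps\<close>)
    then show ?thesis by (simp only: mult.assoc[symmetric])
  qed
  finally show ?case .
qed

lemma strips_descending: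
  assumes t: "weights r t"
    and desc: "\<And>i m. 1 \<le> i \<Longrightarrow> i \<le> r \<Longrightarrow> j + int a \<le> m \<Longrightarrow> m < j + int a + int n \<Longrightarrow> S i (m + 1) < S i m"
  shows "strips r S t j (a + n) f (\<lambda>l. \<alpha> < l) =
    (\<Prod>i=1..r. if \<alpha> \<le> i then t i (j + int a) / t i (j + int a + int n) else 1) * strips r S t j a f (\<lambda>l. \<alpha> < l)"
  using desc
proof (induction n)
  case 0
  have "(if \<alpha> \<le> i then t i (j + int a) / t i (j + int a + int 0) else 1) = 1" for i
    using t by (simp add: weights_def)
  then show ?case by (simp only: prod.neutral_const mult_1_left add_0_right)
next
  case (Suc n)
  let ?I = "\<lambda>l. \<alpha> < (l::nat)" and ?m = "j + int a + int n"
  have "strips r S t j (a + Suc n) f ?I = strip r S t ?m (strips r S t j (a + n) f) ?I"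
    by (simp add: add_ac)
  also have "\<dots> = (\<Prod>i=1..r. if \<alpha> \<le> i then t i ?m / t i (?m + 1) else 1) * strips r S t j (a + n) f ?I"
    unfolding strip_def
  proof (rule oprod_scale_at)
    fix i g assume "1 \<le> i" "i \<le> r"
    then have "\<not> S i ?m < S i (?m + 1)" using Suc.prems[of i ?m] by simp
    then show "row_op S t (diag_order S ?m) ?m i g ?I = (if \<alpha> \<le> i then t i ?m / t i (?m + 1) else 1) * g ?I"
      by (simp add: row_op_def opU_highest_weight)
  qed
  also have "strips r S t j (a + n) f ?I =
      (\<Prod>i=1..r. if \<alpha> \<le> i then t i (j + int a) / t i ?m else 1) * strips r S t j a f ?I"
    using Suc by simp
  also have "(\<Prod>i=1..r. if \<alpha> \<le> i then t i ?m / t i (?m + 1) else 1) *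
      ((\<Prod>i=1..r. if \<alpha> \<le> i then t i (j + int a) / t i ?m else 1) * strips r S t j a f ?I) =
      (\<Prod>i=1..r. if \<alpha> \<le> i then t i (j + int a) / t i (j + int a + int (Suc n)) else 1) * strips r S t j a f ?I"
  proof -
    have "(\<Prod>i=1..r. if \<alpha> \<le> i then t i ?m / t i (?m + 1) else 1) *
        (\<Prod>i=1..r. if \<alpha> \<le> i then t i (j + int a) / t i ?m else 1)
        = (\<Prod>i=1..r. if \<alpha> \<le> i then t i (j + int a) / t i (j + int a + int (Suc n)) else 1)"
      unfolding prod.distrib[symmetric]
      by (rule prod.cong) (use t in \<open>auto simp: weights_def field_simps\<close>)
    then show ?thesis by (simp only: mult.assoc[symmetric])
  qed
  finally show ?case .
qed

text \<open>After telescoping, the summit column contributes the product over \<open>i\<close> \<ge>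
  \<alpha> divided by the product over \<open>i\<close> > \<alpha>, which leaves the single value in
  row \<alpha>. The prefactor cancels the values in the two end columns.\<close>

lemma strips_mountain:
  assumes t: "weights r t" and \<alpha>: "1 \<le> \<alpha>" "\<alpha> \<le> r"
    and asc: "\<And>i m. 1 \<le> i \<Longrightarrow> i \<le> r \<Longrightarrow> j \<le> m \<Longrightarrow> m < j + int a \<Longrightarrow> S i m < S i (m + 1)"
    and desc: "\<And>i m. 1 \<le> i \<Longrightarrow> i \<le> r \<Longrightarrow> j + int a \<le> m \<Longrightarrow> m < j + int a + int n \<Longrightarrow> S i (m + 1) < S i m"
  shows "t \<alpha> (j + int a) =
    (\<Prod>i=1..r. (if \<alpha> \<le> i then t i (j + int a + int n) else 1) * inverse (if \<alpha> < i then t i j else 1)) *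
    strips r S t j (a + n) (\<lambda>J. if J = (\<lambda>l. \<alpha> < l) then 1 else 0) (\<lambda>l. \<alpha> < l)"
proof -
  let ?I = "\<lambda>l. \<alpha> < (l::nat)" and ?f = "\<lambda>J. if J = (\<lambda>l. \<alpha> < l) then 1 else 0 :: 'a"
  let ?c = "\<lambda>i. (if \<alpha> \<le> i then t i (j + int a + int n) else 1) * inverse (if \<alpha> < i then t i j else 1)"
  have nz: "t i m \<noteq> 0" for i m using t by (simp add: weights_def)
  have "strips r S t j (a + n) ?f ?I =
      (\<Prod>i=1..r. if \<alpha> \<le> i then t i (j + int a) / t i (j + int a + int n) else 1) *
      (\<Prod>i=1..r. if \<alpha> < i then t i j / t i (j + int a) else 1)"
  proof -
    have "strips r S t j a ?f = (\<lambda>J. (\<Prod>i=1..r. if \<alpha> < i then t i j / t i (j + int a) else 1) * ?f J)"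
      by (rule strips_ascending[OF t, where \<alpha> = \<alpha>]) (use asc in auto)
    moreover have "strips r S t j (a + n) ?f ?I =
        (\<Prod>i=1..r. if \<alpha> \<le> i then t i (j + int a) / t i (j + int a + int n) else 1) * strips r S t j a ?f ?I"
      by (rule strips_descending[OF t]) (use desc in auto)
    ultimately show ?thesis by simp
  qed
  then have "(\<Prod>i=1..r. ?c i) * strips r S t j (a + n) ?f ?I =
      (\<Prod>i=1..r. ?c i * ((if \<alpha> \<le> i then t i (j + int a) / t i (j + int a + int n) else 1) *
        (if \<alpha> < i then t i j / t i (j + int a) else 1)))"
    by (simp only: prod.distrib)
  also have "\<dots> = (\<Prod>i=1..r. if i = \<alpha> then t i (j + int a) else 1)"
    by (rule prod.cong) (use nz in \<open>auto simp: field_simps\<close>)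
  also have "\<dots> = t \<alpha> (j + int a)" using \<alpha> by simp
  finally show ?thesis by simp
qed

subsection \<open>Positivity above a surface\<close>

text \<open>Abstracts the Laurent polynomials with non-negative coefficients inside their field of
  fractions.\<close>

definition subsemiring :: "'a::field set \<Rightarrow> bool" where
  "subsemiring N \<longleftrightarrow> 0 \<in> N \<and> 1 \<in> N \<and> (\<forall>x\<in>N. \<forall>y\<in>N. x + y \<in> N \<and> x * y \<in> N)"

lemma strips_mem:
  assumes N: "subsemiring N" and t: "\<And>i j. t i j \<in> N" "\<And>i j. inverse (t i j) \<in> N"
    and f: "\<And>J. f J \<in> N"
  shows "strips r S t j n f J \<in> N"
proof -
  have row: "row_op S t p j i f J \<in> N" if "\<And>J. f J \<in> N" for p j i f J
    using N t that by (auto simp: row_op_def opU_def opV_def divide_inverse subsemiring_def)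
  have oprod: "oprod (row_op S t p j) q n f J \<in> N" if "\<And>J. f J \<in> N" for p q j n f J
    using that
  proof (induction n arbitrary: f J)
    case (Suc n)
    then show ?case using row by simp
  qed simp
  show ?thesis
  proof (induction n arbitrary: J)
    case (Suc n)
    then show ?case using oprod by (simp add: strip_def)
  qed (simp add: f)
qed

lemma apex_mem_subsemiring:
  fixes T :: "nat \<Rightarrow> int \<Rightarrow> int \<Rightarrow> 'a::field"
  assumes N: "subsemiring N"
    and s: "stepped_surface r s" and S: "stepped_surface r S"
    and T: "\<And>i j k. T i j k \<noteq> 0" "\<And>j k. T 0 j k = 1" "\<And>j k. T (r + 1) j k = 1"
    and rel: "\<And>i j k. 1 \<le> i \<Longrightarrow> i \<le> r \<Longrightarrow> odd (int i + j + k) \<Longrightarrow> s i j < k \<Longrightarrow> j0 < j \<Longrightarrow> j < j0 + int (a + n) \<Longrightarrow>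
      T i j (k + 1) * T i j (k - 1) = T i (j + 1) k * T i (j - 1) k + T (i + 1) j k * T (i - 1) j k"
    and ge: "\<And>i j. s i j \<le> S i j"
    and off: "\<And>i j. S i j \<noteq> s i j \<Longrightarrow> 1 \<le> i \<and> i \<le> r \<and> j0 < j \<and> j < j0 + int (a + n)"
    and \<alpha>: "1 \<le> \<alpha>" "\<alpha> \<le> r"
    and asc: "\<And>i m. 1 \<le> i \<Longrightarrow> i \<le> r \<Longrightarrow> j0 \<le> m \<Longrightarrow> m < j0 + int a \<Longrightarrow> S i m < S i (m + 1)"
    and desc: "\<And>i m. 1 \<le> i \<Longrightarrow> i \<le> r \<Longrightarrow> j0 + int a \<le> m \<Longrightarrow> m < j0 + int a + int n \<Longrightarrow> S i (m + 1) < S i m"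
    and mem: "\<And>i j. T i j (s i j) \<in> N" "\<And>i j. inverse (T i j (s i j)) \<in> N"
  shows "T \<alpha> (j0 + int a) (S \<alpha> (j0 + int a)) \<in> N"
proof -
  let ?t = "\<lambda>i j. T i j (S i j)" and ?f = "\<lambda>J. if J = (\<lambda>l. \<alpha> < l) then 1 else 0 :: 'a"
  have one: "0 \<in> N" "1 \<in> N" and cl: "\<And>x y. x \<in> N \<Longrightarrow> y \<in> N \<Longrightarrow> x * y \<in> N"
    using N by (auto simp: subsemiring_def)
  have prod: "(\<Prod>i\<in>A. c i) \<in> N" if "\<And>i. c i \<in> N" for A :: "nat set" and c
    using one cl that by (induction A rule: infinite_finite_induct) auto
  \<comment> \<open>The surfaces may differ only strictly between the end columns, so the prefactor
    of the mountain consists of initial data.\<close>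
  have b: "S i j0 = s i j0" "S i (j0 + int a + int n) = s i (j0 + int a + int n)" for i
    using off[of i j0] off[of i "j0 + int a + int n"] by auto
  have "?t \<alpha> (j0 + int a) =
    (\<Prod>i=1..r. (if \<alpha> \<le> i then ?t i (j0 + int a + int n) else 1) * inverse (if \<alpha> < i then ?t i j0 else 1)) *
    strips r S ?t j0 (a + n) ?f (\<lambda>l. \<alpha> < l)"
    by (rule strips_mountain[OF _ \<alpha>]) (use T asc desc in \<open>auto simp: weights_def\<close>)
  also have "strips r S ?t j0 (a + n) ?f = strips r s (\<lambda>i j. T i j (s i j)) j0 (a + n) ?f"
    by (rule strips_invariant[OF s T rel S ge off])
  also have "(\<Prod>i=1..r. (if \<alpha> \<le> i then ?t i (j0 + int a + int n) else 1) * inverse (if \<alpha> < i then ?t i j0 else 1)) *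
      strips r s (\<lambda>i j. T i j (s i j)) j0 (a + n) ?f (\<lambda>l. \<alpha> < l) \<in> N"
    by (intro cl prod strips_mem[OF N]) (use one mem cl in \<open>auto simp: b\<close>)
  finally show ?thesis .
qed

subsection \<open>Solving the T-system upwards\<close>

text \<open>On and below the surface the value is frozen at the initial datum \<open>d i j\<close>.
  The floor \<open>m\<close> makes the recursion terminate for any \<open>s\<close>; if
  \<open>m\<close> bounds \<open>s\<close> from below in rows 1 to \<open>r\<close>, it never stops
  the recursion above the surface.\<close>

function up :: "nat \<Rightarrow> (nat \<Rightarrow> int \<Rightarrow> int) \<Rightarrow> (nat \<Rightarrow> int \<Rightarrow> 'a::field) \<Rightarrow> int \<Rightarrow> nat \<Rightarrow> int \<Rightarrow> int \<Rightarrow> 'a" where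
  "up r s d m i j k = (if i = 0 \<or> r < i then 1 else if k \<le> s i j \<or> k \<le> m then d i j
     else (up r s d m i (j + 1) (k - 1) * up r s d m i (j - 1) (k - 1)
         + up r s d m (i + 1) j (k - 1) * up r s d m (i - 1) j (k - 1)) / up r s d m i j (k - 2))"
  by pat_completeness auto
termination by (relation "measure (\<lambda>(r, s, d, m, i, j, k). nat (k - m))") auto

declare up.simps [simp del]

lemma up_boundary [simp]: "up r s d m 0 j k = 1" "r < i \<Longrightarrow> up r s d m i j k = 1"
  by (simp_all add: up.simps)

lemma up_initial: "1 \<le> i \<Longrightarrow> i \<le> r \<Longrightarrow> k \<le> s i j \<Longrightarrow> up r s d m i j k = d i j"
  by (simp add: up.simps)

definition subsemifield :: "'a::field set \<Rightarrow> bool" where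
  "subsemifield P \<longleftrightarrow> 0 \<notin> P \<and> 1 \<in> P \<and> (\<forall>x\<in>P. \<forall>y\<in>P. x + y \<in> P \<and> x * y \<in> P \<and> x / y \<in> P)"

text \<open>The recursion is subtraction-free. As 0 is not in \<open>P\<close>, this is the source
  of all nonvanishing statements, in particular for denominators.\<close>

lemma up_mem_subsemifield:
  assumes P: "subsemifield P" and d: "\<And>i j. d i j \<in> P"
  shows "up r s d m i j k \<in> P"
  using d
proof (induction r s d m i j k rule: up.induct)
  case (1 r s d m i j k)
  show ?case
  proof (cases "(i = 0 \<or> r < i) \<or> (k \<le> s i j \<or> k \<le> m)")
    case True
    then show ?thesis using P 1(6) by (subst up.simps) (auto simp: subsemifield_def)
  next
    case False
    then show ?thesis using P 1 by (subst up.simps) (simp add: subsemifield_def)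
  qed
qed

lemma up_relation:
  assumes "1 \<le> i" "i \<le> r" "s i j < k" "m \<le> k" "up r s d m i j (k - 1) \<noteq> 0"
  shows "up r s d m i j (k + 1) * up r s d m i j (k - 1) =
    up r s d m i (j + 1) k * up r s d m i (j - 1) k + up r s d m (i + 1) j k * up r s d m (i - 1) j k"
  using assms by (subst up.simps[of _ _ _ _ _ _ "k + 1"]) simp

text \<open>Two surfaces of equal parity differ by even amounts, so one cannot pass the other within
  a step without meeting it; the minimum therefore also moves by exactly 1.\<close>

lemma stepped_surface_min:
  assumes A: "stepped_surface r A" and B: "stepped_surface r B"
    and C: "\<And>i j. 1 \<le> i \<Longrightarrow> i \<le> r \<Longrightarrow> C i j = min (A i j) (B i j)"
  shows "stepped_surface r C"
proof -
  have *: "\<bar>min a' b' - min a b\<bar> = 1"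
    if "\<bar>a' - a\<bar> = 1" "\<bar>b' - b\<bar> = 1" "even (n + a)" "even (n + b)" for a a' b b' n :: int
  proof -
    have "a \<noteq> b + 1" "b \<noteq> a + 1" using that(3,4) by auto
    then show ?thesis using that(1,2) by linarith
  qed
  have "even (int i + j + C i j)" if "1 \<le> i" "i \<le> r" for i j
    using stepped_rowD(2)[OF A that, of j] stepped_rowD(2)[OF B that, of j] that by (simp add: C min_def)
  moreover have "\<bar>C (i + 1) j - C i j\<bar> = 1" if "1 \<le> i" "i < r" for i j
    using *[of "A (i + 1) j" "A i j" "B (i + 1) j" "B i j" "int i + j"] that
      stepped_rowD[OF A, of i j] stepped_rowD[OF B, of i j] by (simp add: C)
  moreover have "\<bar>C i (j + 1) - C i j\<bar> = 1" if "1 \<le> i" "i \<le> r" for i j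
    using *[of "A i (j + 1)" "A i j" "B i (j + 1)" "B i j" "int i + j"] that
      stepped_rowD[OF A, of i j] stepped_rowD[OF B, of i j] by (simp add: C)
  ultimately show ?thesis by (simp add: stepped_surface_def)
qed

lemma stepped_surface_cone:
  assumes "even (int \<alpha> + j + k)"
  shows "stepped_surface r (\<lambda>i m. k - \<bar>int i - int \<alpha>\<bar> - \<bar>m - j\<bar>)"
proof -
  have "even (int i + m + (k - \<bar>int i - int \<alpha>\<bar> - \<bar>m - j\<bar>))" for i m
    using assms by auto
  then show ?thesis by (auto simp: stepped_surface_def)
qed

text \<open>Each step of the recursion moves at most one unit sideways for one unit down, so a
  computation started under \<open>c\<close> stays under \<open>c\<close>. There it meets only
  initial data at points with \<open>kk\<close> \<le> \<open>c\<close>, where both surfaces and both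
  data coincide.\<close>

lemma up_local:
  assumes kk: "stepped_surface r kk" and c: "stepped_surface r c"
    and s: "\<And>i j. 1 \<le> i \<Longrightarrow> i \<le> r \<Longrightarrow> s i j = min (kk i j) (c i j)"
    and d: "\<And>i j. kk i j \<le> c i j \<Longrightarrow> d i j = x i j"
    and m: "\<And>i j. 1 \<le> i \<Longrightarrow> i \<le> r \<Longrightarrow> m \<le> kk i j" "m' \<le> m"
  shows "1 \<le> i \<Longrightarrow> i \<le> r \<Longrightarrow> even (int i + j + k) \<Longrightarrow> kk i j \<le> k \<Longrightarrow> k \<le> c i j \<Longrightarrow>
    up r s d m' i j k = up r kk x m i j k"
proof (induction "nat (k - m)" arbitrary: i j k rule: less_induct)
  case less
  note i = less.prems(1,2)
  show ?case
  proof (cases "k = kk i j")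
    case True
    then show ?thesis using less.prems s[OF i] d[of i j] by (simp add: up_initial)
  next
    case False
    have par: "even (int i + j + kk i j)" using stepped_rowD(2)[OF kk i] .
    then have k2: "kk i j \<le> k - 2" using less.prems False by presburger
    have mk: "m < k" using m(1)[OF i, of j] k2 by linarith
    have IH: "up r s d m' l a b = up r kk x m l a b"
      if "b < k" "1 \<le> l" "l \<le> r" "even (int l + a + b)" "kk l a \<le> b" "b \<le> c l a" for l a b
      by (rule less.hyps) (use that mk in auto)
    have nb: "up r s d m' l a (k - 1) = up r kk x m l a (k - 1)"
      if "1 \<le> l" "l \<le> r" "even (int l + a + (k - 1))" "\<bar>kk l a - kk i j\<bar> = 1" "\<bar>c l a - c i j\<bar> = 1" for l a
      by (rule IH) (use that k2 less.prems in auto)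
    have 1: "up r s d m' i (j + 1) (k - 1) = up r kk x m i (j + 1) (k - 1)"
      using stepped_rowD(1)[OF kk i, of j] stepped_rowD(1)[OF c i, of j] less.prems by (intro nb) auto
    have 2: "up r s d m' i (j - 1) (k - 1) = up r kk x m i (j - 1) (k - 1)"
      using stepped_rowD(1)[OF kk i, of "j - 1"] stepped_rowD(1)[OF c i, of "j - 1"] less.prems by (intro nb) auto
    have 3: "up r s d m' (i + 1) j (k - 1) = up r kk x m (i + 1) j (k - 1)"
    proof (cases "i = r")
      case False
      then show ?thesis
        using stepped_rowD(3)[OF kk i, of j] stepped_rowD(3)[OF c i, of j] less.prems by (intro nb) auto
    qed simp
    have 4: "up r s d m' (i - 1) j (k - 1) = up r kk x m (i - 1) j (k - 1)"
    proof (cases "i = 1")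
      case False
      then obtain l where l: "i = Suc l" "1 \<le> l" using i by (cases i) auto
      then show ?thesis
        using stepped_rowD(3)[OF kk, of l j] stepped_rowD(3)[OF c, of l j] less.prems
        by (intro nb) (auto simp: abs_minus_commute)
    qed simp
    have 5: "up r s d m' i j (k - 2) = up r kk x m i j (k - 2)"
      by (rule IH) (use less.prems k2 in auto)
    have "up r s d m' i j k = (up r s d m' i (j + 1) (k - 1) * up r s d m' i (j - 1) (k - 1)
         + up r s d m' (i + 1) j (k - 1) * up r s d m' (i - 1) j (k - 1)) / up r s d m' i j (k - 2)"
      by (subst up.simps) (use i s[OF i, of j] k2 mk m(2) in auto)
    also have "\<dots> = up r kk x m i j k"
      unfolding 1 2 3 4 5 by (subst (6) up.simps) (use i k2 mk in auto)
    finally show ?thesis .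
  qed
qed

text \<open>The initial data outside the backward cone of \<open>(\<alpha>, j, k)\<close> do not influence the value
  there, so the surface may be replaced by its minimum with the cone and the data on the new
  part by \<open>1\<close>. The cone itself then is the mountain on which the strip product is evaluated.\<close>
lemma up_mem_subsemiring:
  assumes N: "subsemiring N" and P: "subsemifield P"
    and kk: "stepped_surface r kk" and b: "\<And>i j. 1 \<le> i \<Longrightarrow> i \<le> r \<Longrightarrow> b \<le> kk i j"
    and x: "\<And>i j. x i j \<in> P" "\<And>i j. x i j \<in> N" "\<And>i j. inverse (x i j) \<in> N"
    and \<alpha>: "1 \<le> \<alpha>" "\<alpha> \<le> r" and k: "even (int \<alpha> + j + k)" "kk \<alpha> j \<le> k"
  shows "up r kk x b \<alpha> j k \<in> N"
proof -
  define c where "c = (\<lambda>i m. k - \<bar>int i - int \<alpha>\<bar> - \<bar>m - j\<bar>)"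
  define s where "s = (\<lambda>i m. if 1 \<le> i \<and> i \<le> r then min (kk i m) (c i m) else c i m)"
  define d where "d = (\<lambda>i m. if kk i m \<le> c i m then x i m else 1)"
  \<comment> \<open>The cone exceeds \<open>kk\<close> \<ge> \<open>b\<close> only in columns at
    distance less than \<open>k - b\<close> from \<open>j\<close>. The extra 1 keeps the end columns
    of the window outside this range.\<close>
  define n where "n = nat (k - b) + 1"
  define j0 where "j0 = j - int n"
  \<comment> \<open>Inside the window and rows 1 to \<open>r\<close> the cone stays above
    \<open>k - int r - int n\<close>, so this floor lies below both parts of \<open>s\<close>
    wherever the relation is used.\<close>
  define m where "m = min b (k - int r - int n)"
  let ?T = "up r s d m"
  have c: "stepped_surface r c" unfolding c_def using k(1) by (rule stepped_surface_cone)
  have s: "stepped_surface r s" by (rule stepped_surface_min[OF kk c]) (simp add: s_def)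
  have one: "1 \<in> N" "1 \<in> P" "0 \<notin> P" using N P by (auto simp: subsemiring_def subsemifield_def)
  have d: "d i j \<in> P" "d i j \<in> N" "inverse (d i j) \<in> N" for i j
    using x one by (auto simp: d_def)
  have nz: "?T i j k \<noteq> 0" for i j k
  proof -
    have "?T i j k \<in> P" by (rule up_mem_subsemifield[OF P]) (rule d)
    then show ?thesis using one(3) by metis
  qed
  have jn: "j0 + int n = j" by (simp add: j0_def)
  have "?T \<alpha> (j0 + int n) (c \<alpha> (j0 + int n)) \<in> N"
  proof (rule apex_mem_subsemiring[OF N s c nz _ _ _ _ _ \<alpha>, where n = n])
    fix i j' k' assume h: "1 \<le> i" "i \<le> r" "s i j' < k'" "j0 < j'" "j' < j0 + int (n + n)"
    have "k - int r - int n \<le> c i j'" using h \<alpha> by (auto simp: c_def j0_def)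
    then have "m \<le> s i j'" using h b[of i j'] unfolding s_def m_def by (simp del: min_le_iff_disj) linarith
    then show "?T i j' (k' + 1) * ?T i j' (k' - 1) =
        ?T i (j' + 1) k' * ?T i (j' - 1) k' + ?T (i + 1) j' k' * ?T (i - 1) j' k'"
      using h nz by (intro up_relation) auto
  next
    fix i j' assume ne: "c i j' \<noteq> s i j'"
    then have i: "1 \<le> i" "i \<le> r" and lt: "kk i j' < c i j'" by (auto simp: s_def min_def split: if_splits)
    have "\<bar>j' - j\<bar> < k - b" using lt b[OF i, of j'] by (simp add: c_def)
    then show "1 \<le> i \<and> i \<le> r \<and> j0 < j' \<and> j' < j0 + int (n + n)"
      using i by (auto simp: j0_def n_def)
  next
    fix i j'
    have "?T i j' (s i j') = (if 1 \<le> i \<and> i \<le> r then d i j' else 1)"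
      by (cases "i = 0") (auto simp: up_initial)
    then show "?T i j' (s i j') \<in> N" "inverse (?T i j' (s i j')) \<in> N"
      using d one by auto
  qed (auto simp: s_def c_def j0_def)
  then have "?T \<alpha> j k \<in> N" by (simp add: jn) (simp add: c_def)
  also have "?T \<alpha> j k = up r kk x b \<alpha> j k"
    by (rule up_local[OF kk c _ _ b _ \<alpha> k]) (auto simp: s_def d_def m_def c_def)
  finally show ?thesis .
qed

subsection \<open>Laurent polynomials with non-negative coefficients\<close>

lemma nonneg_coeffs_0: "nonneg_coeffs 0" and nonneg_coeffs_1: "nonneg_coeffs 1"
  by (simp_all add: nonneg_coeffs_def lookup_one when_def)

lemma nonneg_coeffs_add: "nonneg_coeffs p \<Longrightarrow> nonneg_coeffs q \<Longrightarrow> nonneg_coeffs (p + q)"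
  by (simp add: nonneg_coeffs_def lookup_add)

lemma Sum_any_nonneg: "(\<And>a. 0 \<le> f a) \<Longrightarrow> 0 \<le> (Sum_any f :: int)"
  by (simp add: Sum_any.expand_set sum_nonneg)

lemma nonneg_coeffs_mult: "nonneg_coeffs p \<Longrightarrow> nonneg_coeffs q \<Longrightarrow> nonneg_coeffs (p * q)"
  unfolding nonneg_coeffs_def
  by (auto simp: lookup_mult when_def intro!: Sum_any_nonneg mult_nonneg_nonneg)

lemma nonneg_coeffs_single: "0 \<le> c \<Longrightarrow> nonneg_coeffs (Poly_Mapping.single m c)"
  by (simp add: nonneg_coeffs_def lookup_single when_def)

text \<open>Non-negative coefficients cannot cancel; this keeps the numerator of a sum of positive
  fractions nonzero.\<close>

lemma nonneg_coeffs_add_eq_0: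
  assumes "nonneg_coeffs p" "nonneg_coeffs q" "p + q = 0"
  shows "p = 0"
proof (rule poly_mapping_eqI)
  fix m
  have "Poly_Mapping.lookup p m + Poly_Mapping.lookup q m = 0"
    by (simp add: assms(3) flip: lookup_add)
  then show "Poly_Mapping.lookup p m = Poly_Mapping.lookup 0 m"
    using assms(1,2) by (simp add: nonneg_coeffs_def add_nonneg_eq_0_iff)
qed

definition lfract_nonneg :: "laurent fract set" where
  "lfract_nonneg = {to_fract p | p. nonneg_coeffs p}"

definition lfract_pos :: "laurent fract set" where
  "lfract_pos = {to_fract p / to_fract q | p q. nonneg_coeffs p \<and> nonneg_coeffs q \<and> p \<noteq> 0 \<and> q \<noteq> 0}"

lemma subsemiring_lfract_nonneg: "subsemiring lfract_nonneg"
proof -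
  have "0 \<in> lfract_nonneg" "1 \<in> lfract_nonneg"
    unfolding lfract_nonneg_def
    by (force intro: exI[of _ 0] exI[of _ 1] simp: nonneg_coeffs_0 nonneg_coeffs_1)+
  moreover have "x + y \<in> lfract_nonneg" "x * y \<in> lfract_nonneg"
    if "x \<in> lfract_nonneg" "y \<in> lfract_nonneg" for x y
    using that nonneg_coeffs_add nonneg_coeffs_mult unfolding lfract_nonneg_def
    by (auto simp flip: to_fract_add to_fract_mult)
  ultimately show ?thesis by (simp add: subsemiring_def)
qed

lemma lfract_posI:
  "nonneg_coeffs p \<Longrightarrow> nonneg_coeffs q \<Longrightarrow> p \<noteq> 0 \<Longrightarrow> q \<noteq> 0 \<Longrightarrow> z = to_fract p / to_fract q \<Longrightarrow> z \<in> lfract_pos"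
  unfolding lfract_pos_def by blast

lemma subsemifield_lfract_pos: "subsemifield lfract_pos"
proof -
  have "0 \<notin> lfract_pos" by (auto simp: lfract_pos_def)
  moreover have "1 \<in> lfract_pos"
    by (rule lfract_posI[of 1 1]) (simp_all add: nonneg_coeffs_1)
  moreover have "x + y \<in> lfract_pos \<and> x * y \<in> lfract_pos \<and> x / y \<in> lfract_pos"
    if xy: "x \<in> lfract_pos" "y \<in> lfract_pos" for x y
  proof -
    obtain p q where p: "nonneg_coeffs p" "nonneg_coeffs q" "p \<noteq> 0" "q \<noteq> 0" "x = to_fract p / to_fract q"
      using xy(1) unfolding lfract_pos_def by blast
    obtain u v where u: "nonneg_coeffs u" "nonneg_coeffs v" "u \<noteq> 0" "v \<noteq> 0" "y = to_fract u / to_fract v"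
      using xy(2) unfolding lfract_pos_def by blast
    have "p * v + u * q \<noteq> 0"
      using nonneg_coeffs_add_eq_0[of "p * v" "u * q"] p u by (auto simp: nonneg_coeffs_mult)
    then have "x + y \<in> lfract_pos"
      using p u by (intro lfract_posI[of "p * v + u * q" "q * v"])
        (auto simp: nonneg_coeffs_mult nonneg_coeffs_add add_frac_eq)
    moreover have "x * y \<in> lfract_pos"
      using p u by (intro lfract_posI[of "p * u" "q * v"]) (auto simp: nonneg_coeffs_mult)
    moreover have "x / y \<in> lfract_pos"
      using p u by (intro lfract_posI[of "p * v" "q * u"]) (auto simp: nonneg_coeffs_mult)
    ultimately show ?thesis by blast
  qed
  ultimately show ?thesis by (simp add: subsemifield_def)
qed

lemma lvar_inverse: "lvar a j * Poly_Mapping.single (Poly_Mapping.single (a, j) (-1)) 1 = 1"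
  by (simp add: lvar_def mult_single flip: single_add)

lemma lvar_mem:
  shows "to_fract (lvar a j) \<in> lfract_nonneg" "inverse (to_fract (lvar a j)) \<in> lfract_nonneg"
    "to_fract (lvar a j) \<in> lfract_pos"
proof -
  have n: "nonneg_coeffs (lvar a j)" by (simp add: lvar_def nonneg_coeffs_single)
  have nz: "lvar a j \<noteq> 0" using lvar_inverse[of a j] by auto
  let ?y = "Poly_Mapping.single (Poly_Mapping.single (a, j) (-1)) 1 :: laurent"
  show "to_fract (lvar a j) \<in> lfract_nonneg" using n by (auto simp: lfract_nonneg_def)
  have "inverse (to_fract (lvar a j)) = to_fract ?y"
    by (rule inverse_unique) (simp only: lvar_inverse to_fract_1 flip: to_fract_mult)
  then show "inverse (to_fract (lvar a j)) \<in> lfract_nonneg"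
    unfolding lfract_nonneg_def by (auto intro: nonneg_coeffs_single)
  show "to_fract (lvar a j) \<in> lfract_pos"
    by (rule lfract_posI[of "lvar a j" 1]) (use n nz in \<open>simp_all add: nonneg_coeffs_1\<close>)
qed

subsection \<open>Periodic surfaces\<close>

lemma two_periodic:
  fixes f :: "int \<Rightarrow> 'b"
  assumes "\<And>j. f (j + 2) = f j"
  shows "f j = f (j mod 2)"
proof -
  have nat: "f (j + 2 * int n) = f j" for j n
  proof (induction n)
    case (Suc n)
    then show ?case using assms[of "j + 2 * int n"] by (simp add: algebra_simps)
  qed simp
  show ?thesis
  proof (cases "0 \<le> j div 2")
    case True
    then show ?thesis using nat[of "j mod 2" "nat (j div 2)"] by simp
  next
    case False
    then have "j + 2 * int (nat (- (j div 2))) = j mod 2"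
      using mult_div_mod_eq[of 2 j] by linarith
    then show ?thesis using nat[of j "nat (- (j div 2))"] by simp
  qed
qed

theorem mainTheorem7:
  fixes r :: nat and kk :: "nat \<Rightarrow> int \<Rightarrow> int"
  assumes "r \<ge> 1"
    and "stepped_surface r kk"
    and "\<forall>a j. 1 \<le> a \<and> a \<le> r \<longrightarrow> kk a (j+2) = kk a j"
  shows "\<exists>T :: nat \<Rightarrow> int \<Rightarrow> int \<Rightarrow> laurent.
           T_system r T \<and>
           (\<forall>a j. 1 \<le> a \<and> a \<le> r \<longrightarrow> T a j (kk a j) = lvar a j) \<and>
           (\<forall>a j k. 1 \<le> a \<and> a \<le> r \<and> even (int a + j + k) \<longrightarrow> nonneg_coeffs (T a j k))"
proof -
  note kk = assms(2)
  \<comment> \<open>The T-system is invariant under \<open>k\<close> to \<open>- k\<close>. Values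
    below the surface are obtained by solving upwards from the reflected surface.\<close>
  define nk where "nk = (\<lambda>i j. - kk i j)"
  have nk: "stepped_surface r nk"
    using kk unfolding stepped_surface_def nk_def by (simp add: abs_minus_commute)
  \<comment> \<open>By periodicity each row takes only its values at columns 0 and 1, so
    \<open>- B\<close> is a common floor for the surface and its reflection.\<close>
  define B where "B = (\<Sum>i=1..r. \<bar>kk i 0\<bar> + \<bar>kk i 1\<bar>)"
  have B: "\<bar>kk i j\<bar> \<le> B" if i: "1 \<le> i" "i \<le> r" for i j
  proof -
    have "kk i j = kk i (j mod 2)" by (rule two_periodic) (use assms(3) i in auto)
    moreover have "j mod 2 = 0 \<or> j mod 2 = 1" by auto
    moreover have "\<bar>kk i 0\<bar> + \<bar>kk i 1\<bar> \<le> B"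
      unfolding B_def by (rule member_le_sum[where f = "\<lambda>i. \<bar>kk i 0\<bar> + \<bar>kk i 1\<bar>"]) (use i in auto)
    ultimately show ?thesis by auto
  qed
  have b: "- B \<le> kk i j" "- B \<le> nk i j" if "1 \<le> i" "i \<le> r" for i j
    using B[OF that, of j] by (auto simp: nk_def)
  define x where "x = (\<lambda>i j. to_fract (lvar i j))"
  have x: "x i j \<in> lfract_pos" "x i j \<in> lfract_nonneg" "inverse (x i j) \<in> lfract_nonneg" for i j
    by (simp_all add: x_def lvar_mem)
  define U where "U = up r kk x (- B)"
  define D where "D = (\<lambda>i j k. up r nk x (- B) i j (- k))"
  define G where "G = (\<lambda>i j k. if kk i j \<le> k then U i j k else D i j k)"
  have bd: "U i j k = 1" "D i j k = 1" if "i = 0 \<or> r < i" for i j k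
    using that by (auto simp: U_def D_def)
  have init: "U i j (kk i j) = x i j" "D i j (kk i j) = x i j" if "1 \<le> i" "i \<le> r" for i j
    using that by (simp_all add: U_def D_def up_initial nk_def)
  have GU: "G i j k = U i j k" if "kk i j \<le> k \<or> i = 0 \<or> r < i" for i j k
    using that bd[of i j k] by (auto simp: G_def)
  have GD: "G i j k = D i j k" if "k \<le> kk i j \<or> i = 0 \<or> r < i" for i j k
    using that bd[of i j k] init[of i j] by (cases "k = kk i j"; cases "i = 0 \<or> r < i") (auto simp: G_def)
  have G: "G i j k \<in> lfract_nonneg" if "1 \<le> i" "i \<le> r" "even (int i + j + k)" for i j k
  proof (cases "kk i j \<le> k")
    case True
    have "U i j k \<in> lfract_nonneg"
      unfolding U_def
      by (rule up_mem_subsemiring[OF subsemiring_lfract_nonneg subsemifield_lfract_pos kk b(1) x])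
        (use that True in auto)
    then show ?thesis using True by (simp add: G_def)
  next
    case False
    have "D i j k \<in> lfract_nonneg"
      unfolding D_def
      by (rule up_mem_subsemiring[OF subsemiring_lfract_nonneg subsemifield_lfract_pos nk b(2) x])
        (use that False in \<open>auto simp: nk_def\<close>)
    then show ?thesis using False by (simp add: G_def)
  qed
  have nz: "U i j k \<noteq> 0" "D i j k \<noteq> 0" for i j k
  proof -
    have "U i j k \<in> lfract_pos" "D i j k \<in> lfract_pos"
      unfolding U_def D_def by (rule up_mem_subsemifield[OF subsemifield_lfract_pos], rule x)+
    then show "U i j k \<noteq> 0" "D i j k \<noteq> 0"
      using subsemifield_lfract_pos unfolding subsemifield_def by metis+
  qed
  have rel: "G i j (k + 1) * G i j (k - 1) = G i (j + 1) k * G i (j - 1) k + G (i + 1) j k * G (i - 1) j k"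
    if i: "1 \<le> i" "i \<le> r" and odd: "odd (int i + j + k)" for i j k
  proof -
    \<comment> \<open>By parity the centre of a relation never lies on the surface, so its six
      points all lie weakly on one side and the relation belongs entirely to \<open>U\<close> or to
      \<open>D\<close>.\<close>
    have ne: "kk i j \<noteq> k" using stepped_rowD(2)[OF kk i, of j] odd by auto
    have nb1: "\<bar>kk i (j + 1) - kk i j\<bar> = 1" "\<bar>kk i (j - 1) - kk i j\<bar> = 1"
      using stepped_rowD(1)[OF kk i, of j] stepped_rowD(1)[OF kk i, of "j - 1"] by auto
    have nb2: "\<bar>kk (i + 1) j - kk i j\<bar> = 1 \<or> r < i + 1"
      using stepped_rowD(3)[OF kk i, of j] by (cases "i < r") auto
    have nb3: "\<bar>kk (i - 1) j - kk i j\<bar> = 1 \<or> i - 1 = 0"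
    proof (cases "i - 1 = 0")
      case False
      then have l: "1 \<le> i - 1" "i - 1 \<le> r" "i - 1 < r" "i - 1 + 1 = i" using i by auto
      show ?thesis using stepped_rowD(3)[OF kk l(1-3), of j] unfolding l(4) by linarith
    qed simp
    show ?thesis
    proof (cases "kk i j < k")
      case True
      have "G i j (k + 1) = U i j (k + 1)" "G i j (k - 1) = U i j (k - 1)"
        "G i (j + 1) k = U i (j + 1) k" "G i (j - 1) k = U i (j - 1) k"
        "G (i + 1) j k = U (i + 1) j k" "G (i - 1) j k = U (i - 1) j k"
        by (rule GU, use True nb1 nb2 nb3 in linarith)+
      moreover have "U i j (k + 1) * U i j (k - 1) = U i (j + 1) k * U i (j - 1) k + U (i + 1) j k * U (i - 1) j k"
        unfolding U_def
        by (rule up_relation[OF i]) (use True b(1)[OF i, of j] nz(1)[of i j "k - 1"] in \<open>auto simp: U_def\<close>)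
      ultimately show ?thesis by (simp only:)
    next
      case False
      then have lt: "k < kk i j" using ne by simp
      have "G i j (k + 1) = D i j (k + 1)" "G i j (k - 1) = D i j (k - 1)"
        "G i (j + 1) k = D i (j + 1) k" "G i (j - 1) k = D i (j - 1) k"
        "G (i + 1) j k = D (i + 1) j k" "G (i - 1) j k = D (i - 1) j k"
        by (rule GD, use lt nb1 nb2 nb3 in linarith)+
      moreover have "D i j (k - 1) * D i j (k + 1) = D i (j + 1) k * D i (j - 1) k + D (i + 1) j k * D (i - 1) j k"
      proof -
        have e: "- (k - 1) = - k + 1" "- (k + 1) = - k - 1" by simp_all
        show ?thesis unfolding D_def e
          by (rule up_relation[OF i]) (use lt b(2)[OF i, of j] nz(2)[of i j "k + 1"] in \<open>auto simp: nk_def D_def e\<close>)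
      qed
      ultimately show ?thesis by (simp only: mult.commute[of "D i j (k + 1)"])
    qed
  qed
  \<comment> \<open>A preimage with non-negative coefficients is known at even interior points.
    There and on the boundary the relations descend from fractions to Laurent polynomials because
    \<open>to_fract\<close> is injective.\<close>
  define T where "T = (\<lambda>i j k. if i = 0 \<or> r < i then 1 else SOME p. nonneg_coeffs p \<and> to_fract p = G i j k)"
  have T: "nonneg_coeffs (T i j k) \<and> to_fract (T i j k) = G i j k" if "1 \<le> i" "i \<le> r" "even (int i + j + k)" for i j k
  proof -
    have "\<exists>p. nonneg_coeffs p \<and> to_fract p = G i j k"
      using G[OF that] by (auto simp: lfract_nonneg_def)
    from someI_ex[OF this] show ?thesis using that by (simp add: T_def)
  qed
  have TG: "to_fract (T i j k) = G i j k" if "even (int i + j + k)" for i j k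
    using T[of i j k] that bd[of i j k] by (cases "i = 0 \<or> r < i") (auto simp: T_def G_def)
  have "T_system r T"
    unfolding T_system_def
  proof (intro conjI allI impI)
    fix a j k assume a: "1 \<le> a \<and> a \<le> r \<and> odd (int a + j + k)"
    then have "to_fract (T a j (k + 1)) = G a j (k + 1)" "to_fract (T a j (k - 1)) = G a j (k - 1)"
      "to_fract (T a (j + 1) k) = G a (j + 1) k" "to_fract (T a (j - 1) k) = G a (j - 1) k"
      "to_fract (T (a + 1) j k) = G (a + 1) j k" "to_fract (T (a - 1) j k) = G (a - 1) j k"
      by (auto intro!: TG)
    then have "to_fract (T a j (k + 1) * T a j (k - 1)) =
        to_fract (T a (j + 1) k * T a (j - 1) k + T (a + 1) j k * T (a - 1) j k)"
      using rel[of a j k] a by (simp del: One_nat_def)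
    then show "T a j (k + 1) * T a j (k - 1) = T a (j + 1) k * T a (j - 1) k + T (a + 1) j k * T (a - 1) j k"
      by (simp only: to_fract_eq_iff)
  qed (simp_all add: T_def)
  moreover have "T a j (kk a j) = lvar a j" if "1 \<le> a" "a \<le> r" for a j
  proof -
    have "to_fract (T a j (kk a j)) = to_fract (lvar a j)"
      using TG[OF stepped_rowD(2)[OF kk that]] init(1)[OF that] by (simp add: G_def x_def)
    then show ?thesis by simp
  qed
  ultimately show ?thesis using T by blast
qed

end
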